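(* Let $G$ be a second countable locally compact group and let $H<G$ be a closed subgroup such that $H$ is an FT group and $\lambda_{H}$ has infinite multiplicity. Then $G$ is an FT group. In fact, there exist a vector $\varphi\in L^{2}(G)$ and a set $\Gamma\subset H$ such that $(\lambda_{G}(x)\varphi)_{x\in\Gamma}\subset L^{2}(G)$ is a frame for $L^2(G)$.
   Context: For a second countable locally compact group $G$ with left Haar measure, $\lambda_G$ denotes the left regular representation on $L^2(G)$, $(\lambda_G(x)f)(y)=f(x^{-1}y)$. A family $(\eta_i)_{i\in I}$ in a Hilbert space $\mathcal H$ is a frame if there are constants $0<A\le B<\infty$ with $A\|f\|^2\le\sum_{i\in I}|\langle f,\eta_i\rangle|^2\le B\|f\|^2$ for all $f\in\mathcal H$. A second countable locally compact group $G$ is an FT group if there exist $\Gamma\subset G$ and $\varphi\in L^2(G)$ such that $(\lambda_G(x)\varphi)_{x\in\Gamma}$ is a frame for $L^2(G)$. A unitary representation $\pi$ has infinite multiplicity if $\pi$ is unitarily equivalent to $\infty\cdot\pi$, the direct sum of countably infinitely many copies of $\pi$. *)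

theory Defs
  imports "HOL-Analysis.Analysis" "HOL-Algebra.Coset"
begin

text \<open>Topological groups are carrier-based (a group \<open>G\<close> from HOL-Algebra with an abstract topology
  \<open>T\<close> on its carrier), so that a subgroup with the subspace topology is again such an object.\<close>

definition topological_group :: "('a, 'b) monoid_scheme \<Rightarrow> 'a topology \<Rightarrow> bool" where
  "topological_group G T \<longleftrightarrow>
     group G \<and> topspace T = carrier G \<and>
     continuous_map (prod_topology T T) T (\<lambda>(x, y). x \<otimes>\<^bsub>G\<^esub> y) \<and>
     continuous_map T T (\<lambda>x. inv\<^bsub>G\<^esub> x)"

definition second_countable_lc_group :: "('a, 'b) monoid_scheme \<Rightarrow> 'a topology \<Rightarrow> bool" where
  "second_countable_lc_group G T \<longleftrightarrow>
     topological_group G T \<and> Hausdorff_space T \<and> locally_compact_space T \<and> second_countable T"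

text \<open>On a second countable locally compact Hausdorff space every Borel measure that is finite on
  compact sets is regular, so regularity is not part of the following definition.\<close>

definition left_haar_measure ::
    "('a, 'b) monoid_scheme \<Rightarrow> 'a topology \<Rightarrow> 'a measure \<Rightarrow> bool" where
  "left_haar_measure G T \<mu> \<longleftrightarrow>
     space \<mu> = topspace T \<and>
     sets \<mu> = sigma_sets (topspace T) {U. openin T U} \<and>
     emeasure \<mu> (space \<mu>) \<noteq> 0 \<and>
     (\<forall>K. compactin T K \<longrightarrow> emeasure \<mu> K < \<infinity>) \<and>
     (\<forall>x \<in> carrier G. \<forall>A \<in> sets \<mu>. emeasure \<mu> (x <#\<^bsub>G\<^esub> A) = emeasure \<mu> A)"

text \<open>Complex Hilbert spaces as structures with an explicit carrier; the inner product is linear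
  in its first argument.\<close>

record 'v hilbert =
  vecs :: "'v set"
  vadd :: "'v \<Rightarrow> 'v \<Rightarrow> 'v"
  vscale :: "complex \<Rightarrow> 'v \<Rightarrow> 'v"
  vinner :: "'v \<Rightarrow> 'v \<Rightarrow> complex"

definition vnorm :: "'v hilbert \<Rightarrow> 'v \<Rightarrow> real" where
  "vnorm K v = sqrt (Re (vinner K v v))"

definition is_frame :: "'v hilbert \<Rightarrow> 'i set \<Rightarrow> ('i \<Rightarrow> 'v) \<Rightarrow> bool" where
  "is_frame K I \<eta> \<longleftrightarrow>
     (\<forall>i \<in> I. \<eta> i \<in> vecs K) \<and>
     (\<exists>A B :: real. 0 < A \<and> A \<le> B \<and>
       (\<forall>f \<in> vecs K.
          (\<lambda>i. (cmod (vinner K f (\<eta> i)))\<^sup>2) summable_on I \<and>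
          A * (vnorm K f)\<^sup>2 \<le> (\<Sum>\<^sub>\<infinity>i\<in>I. (cmod (vinner K f (\<eta> i)))\<^sup>2) \<and>
          (\<Sum>\<^sub>\<infinity>i\<in>I. (cmod (vinner K f (\<eta> i)))\<^sup>2) \<le> B * (vnorm K f)\<^sup>2))"

text \<open>The Hilbert direct sum of countably infinitely many copies of a space.\<close>

definition infinite_sum_space :: "'v hilbert \<Rightarrow> (nat \<Rightarrow> 'v) hilbert" where
  "infinite_sum_space K =
     \<lparr> vecs = {v. (\<forall>n. v n \<in> vecs K) \<and> summable (\<lambda>n. (vnorm K (v n))\<^sup>2)},
       vadd = (\<lambda>v w n. vadd K (v n) (w n)),
       vscale = (\<lambda>c v n. vscale K c (v n)),
       vinner = (\<lambda>v w. \<Sum>n. vinner K (v n) (w n)) \<rparr>"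

definition unitary_map :: "'v hilbert \<Rightarrow> 'w hilbert \<Rightarrow> ('v \<Rightarrow> 'w) \<Rightarrow> bool" where
  "unitary_map K L U \<longleftrightarrow>
     bij_betw U (vecs K) (vecs L) \<and>
     (\<forall>v \<in> vecs K. \<forall>w \<in> vecs K. U (vadd K v w) = vadd L (U v) (U w)) \<and>
     (\<forall>c. \<forall>v \<in> vecs K. U (vscale K c v) = vscale L c (U v)) \<and>
     (\<forall>v \<in> vecs K. \<forall>w \<in> vecs K. vinner L (U v) (U w) = vinner K v w)"

definition unitarily_equivalent ::
    "('a, 'b) monoid_scheme \<Rightarrow> 'v hilbert \<Rightarrow> ('a \<Rightarrow> 'v \<Rightarrow> 'v) \<Rightarrow>
     'w hilbert \<Rightarrow> ('a \<Rightarrow> 'w \<Rightarrow> 'w) \<Rightarrow> bool" where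
  "unitarily_equivalent G K \<pi> L \<rho> \<longleftrightarrow>
     (\<exists>U. unitary_map K L U \<and> (\<forall>x \<in> carrier G. \<forall>v \<in> vecs K. U (\<pi> x v) = \<rho> x (U v)))"

definition infinite_sum_rep :: "('a \<Rightarrow> 'v \<Rightarrow> 'v) \<Rightarrow> 'a \<Rightarrow> (nat \<Rightarrow> 'v) \<Rightarrow> (nat \<Rightarrow> 'v)" where
  "infinite_sum_rep \<pi> x v = (\<lambda>n. \<pi> x (v n))"

definition infinite_multiplicity ::
    "('a, 'b) monoid_scheme \<Rightarrow> 'v hilbert \<Rightarrow> ('a \<Rightarrow> 'v \<Rightarrow> 'v) \<Rightarrow> bool" where
  "infinite_multiplicity G K \<pi> \<longleftrightarrow>
     unitarily_equivalent G K \<pi> (infinite_sum_space K) (infinite_sum_rep \<pi>)"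

text \<open>Vectors of \<open>L\<^sup>2(\<mu>)\<close> are classes of square integrable functions modulo equality almost
  everywhere. Operations on classes are given on the representative chosen by \<open>L2_rep\<close>;
  the lemmas below show that the choice does not matter.\<close>

definition L2_fun :: "'a measure \<Rightarrow> ('a \<Rightarrow> complex) set" where
  "L2_fun \<mu> = {f \<in> borel_measurable \<mu>. integrable \<mu> (\<lambda>x. (cmod (f x))\<^sup>2)}"

definition L2_class :: "'a measure \<Rightarrow> ('a \<Rightarrow> complex) \<Rightarrow> ('a \<Rightarrow> complex) set" where
  "L2_class \<mu> f = {g \<in> L2_fun \<mu>. AE x in \<mu>. g x = f x}"

definition L2_rep :: "('a \<Rightarrow> complex) set \<Rightarrow> 'a \<Rightarrow> complex" where
  "L2_rep F = (SOME f. f \<in> F)"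

definition L2 :: "'a measure \<Rightarrow> ('a \<Rightarrow> complex) set hilbert" where
  "L2 \<mu> =
     \<lparr> vecs = L2_class \<mu> ` L2_fun \<mu>,
       vadd = (\<lambda>F F'. L2_class \<mu> (\<lambda>x. L2_rep F x + L2_rep F' x)),
       vscale = (\<lambda>c F. L2_class \<mu> (\<lambda>x. c * L2_rep F x)),
       vinner = (\<lambda>F F'. \<integral>x. L2_rep F x * cnj (L2_rep F' x) \<partial>\<mu>) \<rparr>"

definition left_regular ::
    "('a, 'b) monoid_scheme \<Rightarrow> 'a measure \<Rightarrow> 'a \<Rightarrow> ('a \<Rightarrow> complex) set \<Rightarrow> ('a \<Rightarrow> complex) set" where
  "left_regular G \<mu> x F = L2_class \<mu> (\<lambda>y. L2_rep F (inv\<^bsub>G\<^esub> x \<otimes>\<^bsub>G\<^esub> y))"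

definition FT_group :: "('a, 'b) monoid_scheme \<Rightarrow> 'a topology \<Rightarrow> 'a measure \<Rightarrow> bool" where
  "FT_group G T \<mu> \<longleftrightarrow>
     second_countable_lc_group G T \<and> left_haar_measure G T \<mu> \<and>
     (\<exists>\<Gamma> \<phi>. \<Gamma> \<subseteq> carrier G \<and> \<phi> \<in> vecs (L2 \<mu>) \<and>
        is_frame (L2 \<mu>) \<Gamma> (\<lambda>x. left_regular G \<mu> x \<phi>))"


lemma L2_rep_class:
  assumes "f \<in> L2_fun \<mu>"
  shows "L2_rep (L2_class \<mu> f) \<in> L2_fun \<mu>" "AE x in \<mu>. L2_rep (L2_class \<mu> f) x = f x"
proof -
  have "f \<in> L2_class \<mu> f"
    using assms by (simp add: L2_class_def)
  then have "L2_rep (L2_class \<mu> f) \<in> L2_class \<mu> f"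
    unfolding L2_rep_def by (metis someI_ex)
  then show "L2_rep (L2_class \<mu> f) \<in> L2_fun \<mu>" "AE x in \<mu>. L2_rep (L2_class \<mu> f) x = f x"
    by (auto simp: L2_class_def)
qed

lemma L2_class_cong:
  assumes "AE x in \<mu>. f x = g x"
  shows "L2_class \<mu> f = L2_class \<mu> g"
proof -
  have "(AE x in \<mu>. h x = f x) \<longleftrightarrow> (AE x in \<mu>. h x = g x)" for h :: "'a \<Rightarrow> complex"
  proof
    assume "AE x in \<mu>. h x = f x"
    with assms show "AE x in \<mu>. h x = g x" by eventually_elim simp
  next
    assume "AE x in \<mu>. h x = g x"
    with assms show "AE x in \<mu>. h x = f x" by eventually_elim simp
  qed
  then show ?thesis
    by (simp add: L2_class_def)
qed

lemma L2_fun_measurable: "f \<in> L2_fun \<mu> \<Longrightarrow> f \<in> borel_measurable \<mu>"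
  by (simp add: L2_fun_def)

lemma L2_fun_add:
  assumes "f \<in> L2_fun \<mu>" "g \<in> L2_fun \<mu>"
  shows "(\<lambda>x. f x + g x) \<in> L2_fun \<mu>"
proof -
  have [measurable]: "f \<in> borel_measurable \<mu>" "g \<in> borel_measurable \<mu>"
    using assms by (auto simp: L2_fun_def)
  have bd: "integrable \<mu> (\<lambda>x. 2 * (cmod (f x))\<^sup>2 + 2 * (cmod (g x))\<^sup>2)"
    using assms by (auto simp: L2_fun_def)
  have le: "(cmod (f x + g x))\<^sup>2 \<le> 2 * (cmod (f x))\<^sup>2 + 2 * (cmod (g x))\<^sup>2" for x
  proof -
    have "(cmod (f x + g x))\<^sup>2 \<le> (cmod (f x) + cmod (g x))\<^sup>2"
      by (intro power_mono norm_triangle_ineq) simp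
    also have "\<dots> \<le> 2 * (cmod (f x))\<^sup>2 + 2 * (cmod (g x))\<^sup>2"
      using sum_squares_bound[of "cmod (f x)" "cmod (g x)"] by (simp add: power2_sum)
    finally show ?thesis .
  qed
  have "integrable \<mu> (\<lambda>x. (cmod (f x + g x))\<^sup>2)"
    by (rule Bochner_Integration.integrable_bound[OF bd]) (use le in \<open>auto intro!: AE_I2\<close>)
  then show ?thesis
    by (simp add: L2_fun_def)
qed

lemma L2_fun_scale:
  assumes "f \<in> L2_fun \<mu>"
  shows "(\<lambda>x. c * f x) \<in> L2_fun \<mu>"
  using assms by (auto simp: L2_fun_def norm_mult power_mult_distrib)

lemma L2_vadd_class:
  assumes "f \<in> L2_fun \<mu>" "g \<in> L2_fun \<mu>"
  shows "vadd (L2 \<mu>) (L2_class \<mu> f) (L2_class \<mu> g) = L2_class \<mu> (\<lambda>x. f x + g x)"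
proof -
  have "AE x in \<mu>. L2_rep (L2_class \<mu> f) x + L2_rep (L2_class \<mu> g) x = f x + g x"
    using L2_rep_class(2)[OF assms(1)] L2_rep_class(2)[OF assms(2)] by eventually_elim simp
  from L2_class_cong[OF this] show ?thesis
    by (simp add: L2_def)
qed

lemma L2_vscale_class:
  assumes "f \<in> L2_fun \<mu>"
  shows "vscale (L2 \<mu>) c (L2_class \<mu> f) = L2_class \<mu> (\<lambda>x. c * f x)"
proof -
  have "AE x in \<mu>. c * L2_rep (L2_class \<mu> f) x = c * f x"
    using L2_rep_class(2)[OF assms] by eventually_elim simp
  from L2_class_cong[OF this] show ?thesis
    by (simp add: L2_def)
qed

lemma L2_vinner_class:
  assumes "f \<in> L2_fun \<mu>" "g \<in> L2_fun \<mu>"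
  shows "vinner (L2 \<mu>) (L2_class \<mu> f) (L2_class \<mu> g) = (\<integral>x. f x * cnj (g x) \<partial>\<mu>)"
proof -
  note [measurable] = L2_fun_measurable[OF assms(1)] L2_fun_measurable[OF assms(2)]
    L2_fun_measurable[OF L2_rep_class(1)[OF assms(1)]]
    L2_fun_measurable[OF L2_rep_class(1)[OF assms(2)]]
  have cnj: "(\<lambda>x. cnj (h x)) \<in> borel_measurable \<mu>" if "h \<in> borel_measurable \<mu>" for h
    using that by (rule borel_measurable_continuous_on[rotated]) (intro continuous_intros)
  have "AE x in \<mu>. L2_rep (L2_class \<mu> f) x * cnj (L2_rep (L2_class \<mu> g) x) = f x * cnj (g x)"
    using L2_rep_class(2)[OF assms(1)] L2_rep_class(2)[OF assms(2)] by eventually_elim simp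
  then have "(\<integral>x. L2_rep (L2_class \<mu> f) x * cnj (L2_rep (L2_class \<mu> g) x) \<partial>\<mu>) =
      (\<integral>x. f x * cnj (g x) \<partial>\<mu>)"
    by (intro integral_cong_AE borel_measurable_times cnj) measurable
  then show ?thesis
    by (simp add: L2_def)
qed

lemma left_translation_measure:
  fixes G (structure)
  assumes G: "topological_group G T" and \<mu>: "left_haar_measure G T \<mu>" and x: "x \<in> carrier G"
  shows "(\<lambda>y. inv x \<otimes> y) \<in> measurable \<mu> \<mu>"
    and "distr \<mu> \<mu> (\<lambda>y. inv x \<otimes> y) = \<mu>"
proof -
  interpret group G using G by (simp add: topological_group_def)
  have top: "topspace T = carrier G" using G by (simp add: topological_group_def)
  have sp: "space \<mu> = carrier G" using \<mu> top by (simp add: left_haar_measure_def)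
  have sets: "sets \<mu> = sigma_sets (carrier G) {U. openin T U}"
    using \<mu> top by (simp add: left_haar_measure_def)
  have ix: "inv x \<in> carrier G" using x by simp
  have cont: "continuous_map T T (\<lambda>y. inv x \<otimes> y)"
  proof -
    have "continuous_map T (prod_topology T T) (\<lambda>y. (inv x, y))"
      using ix top by (intro continuous_map_pairedI) auto
    from continuous_map_compose[OF this, of T "\<lambda>(x, y). x \<otimes> y"] G show ?thesis
      by (simp add: topological_group_def comp_def)
  qed
  show meas: "(\<lambda>y. inv x \<otimes> y) \<in> measurable \<mu> \<mu>"
  proof (rule measurable_sigma_sets[OF sets])
    show "{U. openin T U} \<subseteq> Pow (carrier G)"
      using openin_subset top by auto
    show "(\<lambda>y. inv x \<otimes> y) \<in> space \<mu> \<rightarrow> carrier G"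
      using ix sp by auto
    show "(\<lambda>y. inv x \<otimes> y) -` U \<inter> space \<mu> \<in> sets \<mu>" if "U \<in> {U. openin T U}" for U
    proof -
      have "openin T {y \<in> topspace T. inv x \<otimes> y \<in> U}"
        using cont that by (simp add: continuous_map_def)
      moreover have "{y \<in> topspace T. inv x \<otimes> y \<in> U} = (\<lambda>y. inv x \<otimes> y) -` U \<inter> space \<mu>"
        using sp top by auto
      ultimately show ?thesis
        unfolding sets by (auto intro: sigma_sets.Basic)
    qed
  qed
  show "distr \<mu> \<mu> (\<lambda>y. inv x \<otimes> y) = \<mu>"
  proof (rule measure_eqI)
    fix A assume "A \<in> sets (distr \<mu> \<mu> (\<lambda>y. inv x \<otimes> y))"
    then have A: "A \<in> sets \<mu>" by simp
    have sub: "A \<subseteq> carrier G" using sets.sets_into_space[OF A] sp by simp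
    have "(\<lambda>y. inv x \<otimes> y) -` A \<inter> space \<mu> = x <# A"
    proof
      show "(\<lambda>y. inv x \<otimes> y) -` A \<inter> space \<mu> \<subseteq> x <# A"
      proof
        fix y assume y: "y \<in> (\<lambda>y. inv x \<otimes> y) -` A \<inter> space \<mu>"
        then have "y = x \<otimes> (inv x \<otimes> y)"
          using x sp by (simp add: m_assoc[symmetric])
        with y show "y \<in> x <# A" by (auto simp: l_coset_def)
      qed
      show "x <# A \<subseteq> (\<lambda>y. inv x \<otimes> y) -` A \<inter> space \<mu>"
      proof
        fix y assume "y \<in> x <# A"
        then obtain a where a: "a \<in> A" "y = x \<otimes> a" by (auto simp: l_coset_def)
        moreover have "a \<in> carrier G" using a sub by auto
        ultimately show "y \<in> (\<lambda>y. inv x \<otimes> y) -` A \<inter> space \<mu>"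
          using x sp by (simp add: m_assoc[symmetric])
      qed
    qed
    then show "emeasure (distr \<mu> \<mu> (\<lambda>y. inv x \<otimes> y)) A = emeasure \<mu> A"
      using \<mu> x A by (simp add: emeasure_distr[OF meas A] left_haar_measure_def)
  qed simp
qed

lemma left_regular_class:
  assumes G: "topological_group G T" and \<mu>: "left_haar_measure G T \<mu>" and x: "x \<in> carrier G"
    and f: "f \<in> L2_fun \<mu>"
  shows "(\<lambda>y. f (inv\<^bsub>G\<^esub> x \<otimes>\<^bsub>G\<^esub> y)) \<in> L2_fun \<mu>"
    and "left_regular G \<mu> x (L2_class \<mu> f) = L2_class \<mu> (\<lambda>y. f (inv\<^bsub>G\<^esub> x \<otimes>\<^bsub>G\<^esub> y))"
proof -
  note tr = left_translation_measure[OF G \<mu> x]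
  have fm: "f \<in> borel_measurable \<mu>" and fi: "integrable \<mu> (\<lambda>y. (cmod (f y))\<^sup>2)"
    using f by (auto simp: L2_fun_def)
  have "integrable (distr \<mu> \<mu> (\<lambda>y. inv\<^bsub>G\<^esub> x \<otimes>\<^bsub>G\<^esub> y)) (\<lambda>y. (cmod (f y))\<^sup>2)"
    using fi tr(2) by simp
  then have "integrable \<mu> (\<lambda>y. (cmod (f (inv\<^bsub>G\<^esub> x \<otimes>\<^bsub>G\<^esub> y)))\<^sup>2)"
    using fm tr(1) by (subst (asm) integrable_distr_eq) auto
  then show "(\<lambda>y. f (inv\<^bsub>G\<^esub> x \<otimes>\<^bsub>G\<^esub> y)) \<in> L2_fun \<mu>"
    using measurable_compose[OF tr(1) fm] by (simp add: L2_fun_def)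
  have "AE y in distr \<mu> \<mu> (\<lambda>y. inv\<^bsub>G\<^esub> x \<otimes>\<^bsub>G\<^esub> y). L2_rep (L2_class \<mu> f) y = f y"
    unfolding tr(2) by (rule L2_rep_class(2)[OF f])
  then have "AE y in \<mu>. L2_rep (L2_class \<mu> f) (inv\<^bsub>G\<^esub> x \<otimes>\<^bsub>G\<^esub> y) = f (inv\<^bsub>G\<^esub> x \<otimes>\<^bsub>G\<^esub> y)"
    using tr(1) L2_fun_measurable[OF L2_rep_class(1)[OF f]] fm
    by (subst (asm) AE_distr_iff) auto
  then show "left_regular G \<mu> x (L2_class \<mu> f) = L2_class \<mu> (\<lambda>y. f (inv\<^bsub>G\<^esub> x \<otimes>\<^bsub>G\<^esub> y))"
    unfolding left_regular_def by (rule L2_class_cong)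
qed

end

theory Submission
  imports Defs
begin

text \<open>No measurable section of the coset space \<open>H \ G\<close> is used. For a Bruhat-type weight \<open>w\<close> with
  \<open>\<integral>\<^sub>H w(h\<^sup>-\<^sup>1g)\<^sup>2 d\<nu>(h) = 1\<close>, Tonelli's theorem and left invariance show that \<open>f \<mapsto> f(hg) w(g)\<close> is an
  isometry of \<open>L\<^sup>2(G)\<close> into \<open>L\<^sup>2(H \<times> G)\<close>, and it intertwines the actions of \<open>H\<close>. Taking coefficients
  along an orthonormal basis in the variable \<open>g\<close> gives an isometric \<open>H\<close>-map of \<open>L\<^sup>2(G)\<close> into
  \<open>\<infinity> \<cdot> L\<^sup>2(H)\<close>, which is \<open>L\<^sup>2(H)\<close> by infinite multiplicity. The adjoint of this map sends the frame vector
  of \<open>H\<close> to a frame vector for \<open>L\<^sup>2(G)\<close>, with the same set \<open>\<Gamma>\<close> and the same bounds.\<close>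

section \<open>The semi-inner product on square integrable functions\<close>

text \<open>A frame asks for less than a decomposition of L^2(G) into copies of L^2(H). If
  \<open>R\<close> is an isometry commuting with \<open>H\<close> and \<open>\<phi>\<close> is the
  adjoint image of the frame vector \<open>\<Phi>\<close>, then the coefficient of \<open>f\<close>
  at \<open>x\<close> equals that of \<open>R f\<close> at \<open>x\<close>, so the frame inequality
  for \<open>R f\<close> is the one for \<open>f\<close>, whatever the range of \<open>R\<close>.
  The lift commutes with \<open>H\<close> because translation by \<open>x\<close> changes
  \<open>h\<close> alone, while the weight sees \<open>g\<close> alone. The obstacle is the weight:
  its orbit integrals must be positive and finite on every orbit at once, although orbits may fail
  to be compact. It is assembled from countably many relatively compact open sets, each of which
  meets all orbits in sets of uniformly bounded Haar measure. A second difficulty is that a lifted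
  function is square integrable only for almost every \<open>h\<close>. Hence the calculations use
  functions and nonnegative integrals, and classes return only when the coefficients are collected.
  The adjoint image comes from a Riesz representation theorem, which rests on completeness and
  separability of L^2(G).\<close>

definition ip :: "'a measure \<Rightarrow> ('a \<Rightarrow> complex) \<Rightarrow> ('a \<Rightarrow> complex) \<Rightarrow> complex" where
  "ip \<mu> f g = (\<integral>x. f x * cnj (g x) \<partial>\<mu>)"

definition nsq :: "'a measure \<Rightarrow> ('a \<Rightarrow> complex) \<Rightarrow> real" where
  "nsq \<mu> f = (\<integral>x. (cmod (f x))\<^sup>2 \<partial>\<mu>)"

lemma borel_measurable_cnj [measurable (raw)]:
  "f \<in> borel_measurable M \<Longrightarrow> (\<lambda>x. cnj (f x)) \<in> borel_measurable M"
  by (rule borel_measurable_continuous_on[of cnj]) (intro continuous_intros)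

lemma L2_fun_zero: "(\<lambda>x. 0) \<in> L2_fun \<mu>"
  by (simp add: L2_fun_def)

lemma L2_fun_diff:
  assumes "f \<in> L2_fun \<mu>" "g \<in> L2_fun \<mu>"
  shows "(\<lambda>x. f x - g x) \<in> L2_fun \<mu>"
  using L2_fun_add[OF assms(1) L2_fun_scale[OF assms(2), of "-1"]] by simp

lemma L2_fun_sum:
  assumes "\<And>i. i \<in> I \<Longrightarrow> f i \<in> L2_fun \<mu>"
  shows "(\<lambda>x. \<Sum>i\<in>I. f i x) \<in> L2_fun \<mu>"
  using assms by (induction I rule: infinite_finite_induct) (auto intro: L2_fun_zero L2_fun_add)

lemma L2_fun_bound:
  assumes "g \<in> L2_fun \<mu>" "f \<in> borel_measurable \<mu>" "AE x in \<mu>. cmod (f x) \<le> cmod (g x)"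
  shows "f \<in> L2_fun \<mu>"
proof -
  have [measurable]: "f \<in> borel_measurable \<mu>" by fact
  have "integrable \<mu> (\<lambda>x. (cmod (f x))\<^sup>2)"
    by (rule Bochner_Integration.integrable_bound[of _ "\<lambda>x. (cmod (g x))\<^sup>2"])
      (use assms in \<open>auto simp: L2_fun_def power_mono\<close>)
  with assms show ?thesis by (simp add: L2_fun_def)
qed

lemma L2_fun_mult_integrable:
  assumes "f \<in> L2_fun \<mu>" "g \<in> L2_fun \<mu>"
  shows "integrable \<mu> (\<lambda>x. f x * cnj (g x))"
proof -
  have [measurable]: "f \<in> borel_measurable \<mu>" "g \<in> borel_measurable \<mu>"
    using assms by (auto simp: L2_fun_def)
  have bd: "integrable \<mu> (\<lambda>x. (cmod (f x))\<^sup>2 + (cmod (g x))\<^sup>2)"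
    using assms by (auto simp: L2_fun_def)
  have "cmod (f x) * cmod (g x) \<le> (cmod (f x))\<^sup>2 + (cmod (g x))\<^sup>2" for x
  proof -
    have "0 \<le> cmod (f x) * cmod (g x)" by simp
    then show ?thesis using sum_squares_bound[of "cmod (f x)" "cmod (g x)"] by linarith
  qed
  then show ?thesis
    by (intro Bochner_Integration.integrable_bound[OF bd]) (auto simp: norm_mult)
qed

lemma nsq_nonneg [simp]: "0 \<le> nsq \<mu> f"
  by (simp add: nsq_def)

lemma ip_self: "ip \<mu> f f = of_real (nsq \<mu> f)"
  unfolding ip_def nsq_def by (simp only: complex_norm_square flip: integral_complex_of_real of_real_power)

lemma ip_commute: "ip \<mu> g f = cnj (ip \<mu> f g)"
  unfolding ip_def by (subst Bochner_Integration.integral_cnj[symmetric]) (simp add: mult.commute)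

lemma ip_add_left:
  assumes "f \<in> L2_fun \<mu>" "g \<in> L2_fun \<mu>" "h \<in> L2_fun \<mu>"
  shows "ip \<mu> (\<lambda>x. f x + g x) h = ip \<mu> f h + ip \<mu> g h"
  using assms by (simp add: ip_def distrib_right L2_fun_mult_integrable)

lemma ip_diff_left:
  assumes "f \<in> L2_fun \<mu>" "g \<in> L2_fun \<mu>" "h \<in> L2_fun \<mu>"
  shows "ip \<mu> (\<lambda>x. f x - g x) h = ip \<mu> f h - ip \<mu> g h"
  using assms by (simp add: ip_def left_diff_distrib L2_fun_mult_integrable)

lemma ip_diff_right:
  assumes "f \<in> L2_fun \<mu>" "g \<in> L2_fun \<mu>" "h \<in> L2_fun \<mu>"
  shows "ip \<mu> h (\<lambda>x. f x - g x) = ip \<mu> h f - ip \<mu> h g"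
  using assms by (simp add: ip_def right_diff_distrib L2_fun_mult_integrable)

lemma ip_scale_left: "ip \<mu> (\<lambda>x. c * f x) g = c * ip \<mu> f g"
  by (simp add: ip_def mult.assoc)

lemma ip_scale_right: "ip \<mu> f (\<lambda>x. c * g x) = cnj c * ip \<mu> f g"
  by (simp add: ip_def mult.left_commute)

lemma ip_sum_left:
  assumes "\<And>i. i \<in> I \<Longrightarrow> f i \<in> L2_fun \<mu>" "h \<in> L2_fun \<mu>"
  shows "ip \<mu> (\<lambda>x. \<Sum>i\<in>I. f i x) h = (\<Sum>i\<in>I. ip \<mu> (f i) h)"
  using assms by (simp add: ip_def sum_distrib_right L2_fun_mult_integrable)

lemma nsq_scale: "nsq \<mu> (\<lambda>x. c * f x) = (cmod c)\<^sup>2 * nsq \<mu> f"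
  by (simp add: nsq_def norm_mult power_mult_distrib)

lemma nsq_diff_commute: "nsq \<mu> (\<lambda>x. f x - g x) = nsq \<mu> (\<lambda>x. g x - f x)"
  by (simp add: nsq_def norm_minus_commute)

lemma nsq_diff:
  assumes "f \<in> L2_fun \<mu>" "g \<in> L2_fun \<mu>"
  shows "nsq \<mu> (\<lambda>x. f x - g x) = nsq \<mu> f + nsq \<mu> g - 2 * Re (ip \<mu> f g)"
proof -
  note * = assms L2_fun_diff[OF assms]
  have "of_real (nsq \<mu> (\<lambda>x. f x - g x)) = ip \<mu> f f - ip \<mu> f g - (ip \<mu> g f - ip \<mu> g g)"
    by (simp add: ip_diff_left ip_diff_right * flip: ip_self)
  then have "Re (of_real (nsq \<mu> (\<lambda>x. f x - g x)))
      = Re (ip \<mu> f f - ip \<mu> f g - (ip \<mu> g f - ip \<mu> g g))"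
    by simp
  then show ?thesis
    by (simp add: ip_self ip_commute[of \<mu> g f])
qed

text \<open>This is the parallelogram law with one term dropped. The factor 2 is harmless, because
  the estimate only serves to show that residuals tend to 0, and it avoids square roots.\<close>

lemma nsq_add_le:
  assumes "f \<in> L2_fun \<mu>" "g \<in> L2_fun \<mu>"
  shows "nsq \<mu> (\<lambda>x. f x + g x) \<le> 2 * nsq \<mu> f + 2 * nsq \<mu> g"
proof -
  have g: "(\<lambda>x. - g x) \<in> L2_fun \<mu>" using L2_fun_scale[OF assms(2), of "-1"] by simp
  have "nsq \<mu> (\<lambda>x. f x - (- g x)) + nsq \<mu> (\<lambda>x. f x - g x)
      = 2 * nsq \<mu> f + 2 * nsq \<mu> g"
    unfolding nsq_diff[OF assms] nsq_diff[OF assms(1) g]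
    by (simp add: ip_def nsq_def)
  then show ?thesis
    using nsq_nonneg[of \<mu> "\<lambda>x. f x - g x"] by (simp del: nsq_nonneg)
qed

text \<open>The form is degenerate, so a function \<open>g\<close> with
  \<open>nsq \<mu> g = 0\<close> is treated separately: it vanishes almost everywhere, which makes
  the integrand zero.\<close>

lemma cauchy_schwarz:
  assumes f: "f \<in> L2_fun \<mu>" and g: "g \<in> L2_fun \<mu>"
  shows "(cmod (ip \<mu> f g))\<^sup>2 \<le> nsq \<mu> f * nsq \<mu> g"
proof (cases "nsq \<mu> g = 0")
  case True
  have [measurable]: "f \<in> borel_measurable \<mu>" "g \<in> borel_measurable \<mu>"
    using assms by (auto simp: L2_fun_def)
  from True g have "AE x in \<mu>. (cmod (g x))\<^sup>2 = 0"
    unfolding nsq_def by (subst (asm) integral_nonneg_eq_0_iff_AE) (auto simp: L2_fun_def)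
  then have "AE x in \<mu>. f x * cnj (g x) = 0" by eventually_elim simp
  then have "ip \<mu> f g = 0"
    unfolding ip_def by (rule integral_eq_zero_AE)
  then show ?thesis by simp
next
  case False
  then have pos: "nsq \<mu> g > 0" using nsq_nonneg[of \<mu> g] by linarith
  \<comment> \<open>\<open>c * g\<close> is the orthogonal projection of \<open>f\<close> onto the
    line of \<open>g\<close>, the choice that minimises the squared distance.\<close>
  define c where "c = ip \<mu> f g / of_real (nsq \<mu> g)"
  have "0 \<le> nsq \<mu> (\<lambda>x. f x - c * g x)" by simp
  also have "\<dots> = nsq \<mu> f + (cmod c)\<^sup>2 * nsq \<mu> g - 2 * Re (cnj c * ip \<mu> f g)"
    by (simp add: nsq_diff f L2_fun_scale[OF g] nsq_scale ip_scale_right)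
  also have "cnj c * ip \<mu> f g = of_real ((cmod (ip \<mu> f g))\<^sup>2 / nsq \<mu> g)"
    by (simp add: c_def mult.commute complex_norm_square flip: of_real_power)
  also have "(cmod c)\<^sup>2 * nsq \<mu> g = (cmod (ip \<mu> f g))\<^sup>2 / nsq \<mu> g"
    using pos by (simp add: c_def norm_divide power_divide power2_eq_square)
  finally have "0 \<le> nsq \<mu> f - (cmod (ip \<mu> f g))\<^sup>2 / nsq \<mu> g" by simp
  then show ?thesis using pos by (simp add: field_simps)
qed

text \<open>Zero vectors are allowed: Gram--Schmidt below produces them (through \<open>1 / 0 = 0\<close>) for linearly
  dependent input, and they contribute nothing to Parseval sums.\<close>

definition orthonormal_seq :: "'a measure \<Rightarrow> (nat \<Rightarrow> 'a \<Rightarrow> complex) \<Rightarrow> bool" where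
  "orthonormal_seq \<mu> e \<longleftrightarrow> (\<forall>n. e n \<in> L2_fun \<mu>) \<and>
     (\<forall>m n. m \<noteq> n \<longrightarrow> ip \<mu> (e m) (e n) = 0) \<and> (\<forall>n. nsq \<mu> (e n) \<in> {0, 1})"

section \<open>Residuals of orthogonal projections, and Gram-Schmidt\<close>

definition residual ::
    "'a measure \<Rightarrow> (nat \<Rightarrow> 'a \<Rightarrow> complex) \<Rightarrow> nat \<Rightarrow> ('a \<Rightarrow> complex) \<Rightarrow> 'a \<Rightarrow> complex" where
  "residual \<mu> e N f = (\<lambda>x. f x - (\<Sum>k<N. ip \<mu> f (e k) * e k x))"

lemma residual_L2_fun:
  assumes "\<And>k. k < N \<Longrightarrow> e k \<in> L2_fun \<mu>" "f \<in> L2_fun \<mu>"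
  shows "residual \<mu> e N f \<in> L2_fun \<mu>"
  unfolding residual_def using assms by (intro L2_fun_diff L2_fun_sum L2_fun_scale) auto

lemma ip_residual:
  assumes "\<And>k. k \<le> N \<Longrightarrow> e k \<in> L2_fun \<mu>" "f \<in> L2_fun \<mu>" "\<And>k. k < N \<Longrightarrow> ip \<mu> (e k) (e N) = 0"
  shows "ip \<mu> (residual \<mu> e N f) (e N) = ip \<mu> f (e N)"
proof -
  have "ip \<mu> (residual \<mu> e N f) (e N)
      = ip \<mu> f (e N) - (\<Sum>k<N. ip \<mu> (\<lambda>x. ip \<mu> f (e k) * e k x) (e N))"
    unfolding residual_def using assms
    by (subst ip_diff_left; (subst ip_sum_left)?) (auto intro!: L2_fun_sum L2_fun_scale)
  then show ?thesis using assms by (simp add: ip_scale_left)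
qed

text \<open>Pythagoras, one vector at a time: the new residual is the old one minus its projection
  onto \<open>e N\<close>. Bessel's inequality is contained in it, since the left side is
  nonnegative.\<close>

lemma nsq_residual:
  assumes e: "orthonormal_seq \<mu> e" and f: "f \<in> L2_fun \<mu>"
  shows "nsq \<mu> (residual \<mu> e N f) = nsq \<mu> f - (\<Sum>k<N. (cmod (ip \<mu> f (e k)))\<^sup>2)"
proof (induction N)
  case 0
  show ?case by (simp add: residual_def)
next
  case (Suc N)
  have eL: "e k \<in> L2_fun \<mu>" for k using e by (simp add: orthonormal_seq_def)
  let ?c = "ip \<mu> f (e N)"
  have "nsq \<mu> (e N) = 0 \<or> nsq \<mu> (e N) = 1" using e by (auto simp: orthonormal_seq_def)
  moreover have "?c = 0" if "nsq \<mu> (e N) = 0"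
    using cauchy_schwarz[OF f eL, of N] that by simp
  ultimately have cN: "(cmod ?c)\<^sup>2 * nsq \<mu> (e N) = (cmod ?c)\<^sup>2" by auto
  have "residual \<mu> e (Suc N) f = (\<lambda>x. residual \<mu> e N f x - ?c * e N x)"
    by (simp add: residual_def fun_eq_iff)
  then have "nsq \<mu> (residual \<mu> e (Suc N) f)
      = nsq \<mu> (residual \<mu> e N f) + (cmod ?c)\<^sup>2 - 2 * Re (cnj ?c * ip \<mu> (residual \<mu> e N f) (e N))"
    using cN by (simp add: nsq_diff nsq_scale ip_scale_right residual_L2_fun L2_fun_scale eL f)
  also have "ip \<mu> (residual \<mu> e N f) (e N) = ?c"
    using e f by (intro ip_residual) (auto simp: orthonormal_seq_def)
  also have "cnj ?c * ?c = of_real ((cmod ?c)\<^sup>2)"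
    by (simp add: complex_norm_square mult.commute del: of_real_power)
  finally show ?case using Suc by simp
qed

fun gram_schmidt :: "'a measure \<Rightarrow> (nat \<Rightarrow> 'a \<Rightarrow> complex) \<Rightarrow> nat \<Rightarrow> 'a \<Rightarrow> complex" where
  "gram_schmidt \<mu> d n =
     (let r = (\<lambda>x. d n x - (\<Sum>k<n. ip \<mu> (d n) (gram_schmidt \<mu> d k) * gram_schmidt \<mu> d k x))
      in (\<lambda>x. of_real (1 / sqrt (nsq \<mu> r)) * r x))"

declare gram_schmidt.simps [simp del]

lemma gram_schmidt_eq:
  "gram_schmidt \<mu> d n = (\<lambda>x. of_real (1 / sqrt (nsq \<mu> (residual \<mu> (gram_schmidt \<mu> d) n (d n)))) *
     residual \<mu> (gram_schmidt \<mu> d) n (d n) x)"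
  by (subst gram_schmidt.simps) (simp add: Let_def residual_def)

lemma gram_schmidt_L2_fun:
  assumes "\<And>n. d n \<in> L2_fun \<mu>"
  shows "gram_schmidt \<mu> d n \<in> L2_fun \<mu>"
proof (induction n rule: less_induct)
  case (less n)
  show ?case
    by (subst gram_schmidt_eq) (intro L2_fun_scale residual_L2_fun less assms)
qed

lemma nsq_gram_schmidt: "nsq \<mu> (gram_schmidt \<mu> d n) \<in> {0, 1}"
proof -
  let ?r = "residual \<mu> (gram_schmidt \<mu> d) n (d n)"
  have "nsq \<mu> (gram_schmidt \<mu> d n) = (1 / sqrt (nsq \<mu> ?r))\<^sup>2 * nsq \<mu> ?r"
    by (subst gram_schmidt_eq) (simp only: nsq_scale norm_of_real power2_abs)
  then show ?thesis by (simp add: power_divide)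
qed

text \<open>By induction the earlier vectors are pairwise orthogonal; conjugate symmetry supplies
  the other order of the indices. Then all terms of the residual but the one at \<open>m\<close>
  vanish, and that one cancels the coefficient of \<open>d n\<close>.\<close>

lemma gram_schmidt_orthogonal:
  assumes d: "\<And>n. d n \<in> L2_fun \<mu>"
  shows "m < n \<Longrightarrow> ip \<mu> (gram_schmidt \<mu> d n) (gram_schmidt \<mu> d m) = 0"
proof (induction n arbitrary: m rule: less_induct)
  case (less n)
  let ?e = "gram_schmidt \<mu> d"
  let ?r = "residual \<mu> ?e n (d n)"
  note eL = gram_schmidt_L2_fun[of d, OF d]
  have orth: "ip \<mu> (?e k) (?e m) = 0" if "k < n" "k \<noteq> m" for k
  proof (cases "m < k")
    case True
    then show ?thesis using less.IH that by blast
  next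
    case False
    then have "ip \<mu> (?e m) (?e k) = 0" using less that by auto
    then show ?thesis by (simp add: ip_commute[of \<mu> "?e k"])
  qed
  have "ip \<mu> ?r (?e m) = ip \<mu> (d n) (?e m) - (\<Sum>k<n. ip \<mu> (\<lambda>x. ip \<mu> (d n) (?e k) * ?e k x) (?e m))"
    unfolding residual_def using d eL
    by (subst ip_diff_left) (auto intro!: L2_fun_sum L2_fun_scale simp: ip_sum_left L2_fun_scale)
  also have "(\<Sum>k<n. ip \<mu> (\<lambda>x. ip \<mu> (d n) (?e k) * ?e k x) (?e m))
      = (\<Sum>k<n. if k = m then ip \<mu> (d n) (?e m) * of_real (nsq \<mu> (?e m)) else 0)"
    by (intro sum.cong) (auto simp: ip_scale_left ip_self orth)
  also have "\<dots> = ip \<mu> (d n) (?e m) * of_real (nsq \<mu> (?e m))"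
    using less.prems by simp
  \<comment> \<open>If \<open>?e m\<close> is a zero vector, the coefficient is itself 0 by
    Cauchy-Schwarz.\<close>
  also have "\<dots> = ip \<mu> (d n) (?e m)"
    using nsq_gram_schmidt[of \<mu> d m] cauchy_schwarz[of "d n" \<mu> "?e m", OF d eL] by auto
  finally have "ip \<mu> ?r (?e m) = 0" by simp
  then show ?case
    by (subst gram_schmidt_eq) (simp only: ip_scale_left mult_zero_right)
qed

lemma orthonormal_gram_schmidt:
  assumes d: "\<And>n. d n \<in> L2_fun \<mu>"
  shows "orthonormal_seq \<mu> (gram_schmidt \<mu> d)"
proof -
  have "ip \<mu> (gram_schmidt \<mu> d m) (gram_schmidt \<mu> d n) = 0" if "m \<noteq> n" for m n
    using gram_schmidt_orthogonal[OF d, of m n] gram_schmidt_orthogonal[OF d, of n m]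
      ip_commute[of \<mu> "gram_schmidt \<mu> d m" "gram_schmidt \<mu> d n"] that
    by (cases "m < n") auto
  then show ?thesis
    unfolding orthonormal_seq_def using nsq_gram_schmidt gram_schmidt_L2_fun[of d \<mu>, OF d]
    by (intro conjI allI impI)
qed

text \<open>For orthonormal \<open>e\<close> this is the closed linear span of \<open>e\<close> in
  the seminorm given by \<open>nsq\<close>. Parseval's identity is the form that is used later,
  while the closure properties are proved through residuals tending to 0.\<close>

definition parseval_set :: "'a measure \<Rightarrow> (nat \<Rightarrow> 'a \<Rightarrow> complex) \<Rightarrow> ('a \<Rightarrow> complex) set" where
  "parseval_set \<mu> e = {f \<in> L2_fun \<mu>. (\<lambda>n. (cmod (ip \<mu> f (e n)))\<^sup>2) sums nsq \<mu> f}"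

lemma parseval_set_iff:
  assumes "orthonormal_seq \<mu> e"
  shows "f \<in> parseval_set \<mu> e \<longleftrightarrow> f \<in> L2_fun \<mu> \<and> (\<lambda>N. nsq \<mu> (residual \<mu> e N f)) \<longlonglongrightarrow> 0"
proof (cases "f \<in> L2_fun \<mu>")
  case True
  let ?s = "\<lambda>N. \<Sum>k<N. (cmod (ip \<mu> f (e k)))\<^sup>2"
  have "(\<lambda>N. nsq \<mu> f - ?s N) \<longlonglongrightarrow> 0" if "?s \<longlonglongrightarrow> nsq \<mu> f"
    using tendsto_diff[OF tendsto_const that, of "nsq \<mu> f"] by simp
  moreover have "?s \<longlonglongrightarrow> nsq \<mu> f" if "(\<lambda>N. nsq \<mu> f - ?s N) \<longlonglongrightarrow> 0"
    using tendsto_diff[OF tendsto_const that, of "nsq \<mu> f"] by simp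
  ultimately show ?thesis
    using True by (auto simp: parseval_set_def nsq_residual[OF assms True] sums_def)
qed (simp add: parseval_set_def)

text \<open>Up to a null function, \<open>d n\<close> lies in the span of the first
  \<open>n + 1\<close> Gram-Schmidt vectors, so its residual has norm 0 from that index on.\<close>

lemma gram_schmidt_in_parseval_set:
  assumes d: "\<And>n. d n \<in> L2_fun \<mu>"
  shows "d n \<in> parseval_set \<mu> (gram_schmidt \<mu> d)"
proof -
  let ?e = "gram_schmidt \<mu> d"
  let ?r = "residual \<mu> ?e n (d n)"
  note on = orthonormal_gram_schmidt[of d, OF d]
  have "ip \<mu> (d n) (?e n) = ip \<mu> ?r (?e n)"
    using on d by (intro ip_residual[symmetric]) (auto simp: orthonormal_seq_def)
  also have "\<dots> = of_real (1 / sqrt (nsq \<mu> ?r)) * ip \<mu> ?r ?r"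
    unfolding arg_cong[OF gram_schmidt_eq[of \<mu> d n], of "ip \<mu> ?r"]
    by (simp only: ip_scale_right complex_cnj_complex_of_real)
  finally have "cmod (ip \<mu> (d n) (?e n)) = cmod (of_real (1 / sqrt (nsq \<mu> ?r) * nsq \<mu> ?r))"
    by (simp only: ip_self of_real_mult)
  \<comment> \<open>\<open>t / sqrt t = sqrt t\<close> also holds for \<open>t = 0\<close>, so a
    linearly dependent \<open>d n\<close> is covered as well.\<close>
  also have "\<dots> = sqrt (nsq \<mu> ?r)"
    by (simp only: norm_of_real) (simp add: real_div_sqrt)
  finally have "(cmod (ip \<mu> (d n) (?e n)))\<^sup>2 = nsq \<mu> ?r"
    by simp
  then have "nsq \<mu> (residual \<mu> ?e (Suc n) (d n)) = 0"
    using d by (simp add: nsq_residual[OF on])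
  then have "nsq \<mu> (residual \<mu> ?e N (d n)) = 0" if "N \<ge> Suc n" for N
  proof -
    \<comment> \<open>Residual norms decrease, because each further index subtracts a nonnegative
      term.\<close>
    have "(\<Sum>k<Suc n. (cmod (ip \<mu> (d n) (?e k)))\<^sup>2) \<le> (\<Sum>k<N. (cmod (ip \<mu> (d n) (?e k)))\<^sup>2)"
      using that by (intro sum_mono2) auto
    then have "nsq \<mu> (residual \<mu> ?e N (d n)) \<le> nsq \<mu> (residual \<mu> ?e (Suc n) (d n))"
      by (simp only: nsq_residual[OF on d])
    then show ?thesis
      using \<open>nsq \<mu> (residual \<mu> ?e (Suc n) (d n)) = 0\<close> nsq_nonneg[of \<mu> "residual \<mu> ?e N (d n)"]
      by linarith
  qed
  then have "(\<lambda>N. nsq \<mu> (residual \<mu> ?e N (d n))) \<longlonglongrightarrow> 0"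
    by (intro tendsto_eventually) (auto simp: eventually_sequentially)
  then show ?thesis using d by (simp add: parseval_set_iff[OF on])
qed

lemma residual_add:
  assumes "\<And>k. e k \<in> L2_fun \<mu>" "f \<in> L2_fun \<mu>" "g \<in> L2_fun \<mu>"
  shows "residual \<mu> e N (\<lambda>x. f x + g x) = (\<lambda>x. residual \<mu> e N f x + residual \<mu> e N g x)"
proof
  fix x
  have "(\<Sum>k<N. ip \<mu> (\<lambda>x. f x + g x) (e k) * e k x)
      = (\<Sum>k<N. ip \<mu> f (e k) * e k x) + (\<Sum>k<N. ip \<mu> g (e k) * e k x)"
    unfolding ip_add_left[OF assms(2,3,1)] distrib_right sum.distrib ..
  then show "residual \<mu> e N (\<lambda>x. f x + g x) x = residual \<mu> e N f x + residual \<mu> e N g x"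
    by (simp only: residual_def add_diff_add)
qed

lemma parseval_set_add:
  assumes e: "orthonormal_seq \<mu> e" and f: "f \<in> parseval_set \<mu> e" and g: "g \<in> parseval_set \<mu> e"
  shows "(\<lambda>x. f x + g x) \<in> parseval_set \<mu> e"
proof -
  have L: "f \<in> L2_fun \<mu>" "g \<in> L2_fun \<mu>" "\<And>k. e k \<in> L2_fun \<mu>"
    and lim: "(\<lambda>N. nsq \<mu> (residual \<mu> e N f)) \<longlonglongrightarrow> 0" "(\<lambda>N. nsq \<mu> (residual \<mu> e N g)) \<longlonglongrightarrow> 0"
    using assms by (auto simp: parseval_set_iff orthonormal_seq_def)
  have le: "nsq \<mu> (residual \<mu> e N (\<lambda>x. f x + g x))
      \<le> 2 * nsq \<mu> (residual \<mu> e N f) + 2 * nsq \<mu> (residual \<mu> e N g)" for N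
    using L by (simp add: residual_add nsq_add_le residual_L2_fun)
  have "(\<lambda>N. 2 * nsq \<mu> (residual \<mu> e N f) + 2 * nsq \<mu> (residual \<mu> e N g)) \<longlonglongrightarrow> 2 * 0 + 2 * 0"
    by (intro tendsto_intros lim)
  then have "(\<lambda>N. 2 * nsq \<mu> (residual \<mu> e N f) + 2 * nsq \<mu> (residual \<mu> e N g)) \<longlonglongrightarrow> 0"
    by simp
  then have "(\<lambda>N. nsq \<mu> (residual \<mu> e N (\<lambda>x. f x + g x))) \<longlonglongrightarrow> 0"
    by (rule Lim_null_comparison[OF always_eventually, rotated]) (simp add: le)
  then show ?thesis using L by (simp add: parseval_set_iff[OF e] L2_fun_add)
qed

lemma parseval_set_scale:
  assumes f: "f \<in> parseval_set \<mu> e"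
  shows "(\<lambda>x. c * f x) \<in> parseval_set \<mu> e"
  using f by (auto simp: parseval_set_def L2_fun_scale ip_scale_left nsq_scale norm_mult
      power_mult_distrib intro: sums_mult)

lemma parseval_set_diff:
  assumes "orthonormal_seq \<mu> e" "f \<in> parseval_set \<mu> e" "g \<in> parseval_set \<mu> e"
  shows "(\<lambda>x. f x - g x) \<in> parseval_set \<mu> e"
  using parseval_set_add[OF assms(1,2) parseval_set_scale[OF assms(3), of "-1"]] by simp

lemma parseval_set_zero: "(\<lambda>x. 0) \<in> parseval_set \<mu> e"
  by (simp add: parseval_set_def L2_fun_zero nsq_def ip_def)

lemma parseval_set_sum:
  assumes "orthonormal_seq \<mu> e" "\<And>i. i \<in> I \<Longrightarrow> f i \<in> parseval_set \<mu> e"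
  shows "(\<lambda>x. \<Sum>i\<in>I. f i x) \<in> parseval_set \<mu> e"
  using assms(2) by (induction I rule: infinite_finite_induct)
    (auto intro: parseval_set_zero parseval_set_add[OF assms(1)])

text \<open>Taking residuals is linear and does not increase \<open>nsq\<close>, so the residuals of
  \<open>f\<close> are controlled by those of one close \<open>g i\<close> plus the distance. The
  threshold \<open>r / 4\<close> is matched to the two factors 2 of
  \<open>nsq_add_le\<close>.\<close>

lemma parseval_set_limit:
  assumes e: "orthonormal_seq \<mu> e" and f: "f \<in> L2_fun \<mu>"
    and g: "\<And>i. g i \<in> parseval_set \<mu> e"
    and lim: "(\<lambda>i. nsq \<mu> (\<lambda>x. f x - g i x)) \<longlonglongrightarrow> 0"
  shows "f \<in> parseval_set \<mu> e"
proof -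
  have L: "\<And>i. g i \<in> L2_fun \<mu>" "\<And>k. e k \<in> L2_fun \<mu>"
    using assms by (auto simp: parseval_set_def orthonormal_seq_def)
  have "(\<lambda>N. nsq \<mu> (residual \<mu> e N f)) \<longlonglongrightarrow> 0"
  proof (rule LIMSEQ_I)
    fix r :: real assume r: "0 < r"
    then obtain i where i: "nsq \<mu> (\<lambda>x. f x - g i x) < r / 4"
      using LIMSEQ_D[OF lim, of "r/4"] by auto
    have "(\<lambda>N. nsq \<mu> (residual \<mu> e N (g i))) \<longlonglongrightarrow> 0" using g by (simp add: parseval_set_iff[OF e])
    then obtain N0 where N0: "\<And>N. N \<ge> N0 \<Longrightarrow> nsq \<mu> (residual \<mu> e N (g i)) < r / 4"
      using LIMSEQ_D[of _ 0 "r/4"] r by fastforce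
    have "nsq \<mu> (residual \<mu> e N f) < r" if "N \<ge> N0" for N
    proof -
      have "nsq \<mu> (residual \<mu> e N f) = nsq \<mu> (residual \<mu> e N (\<lambda>x. (f x - g i x) + g i x))" by simp
      also have "\<dots> \<le> 2 * nsq \<mu> (residual \<mu> e N (\<lambda>x. f x - g i x)) + 2 * nsq \<mu> (residual \<mu> e N (g i))"
        using L f by (subst residual_add) (auto intro!: nsq_add_le residual_L2_fun L2_fun_diff)
      also have "nsq \<mu> (residual \<mu> e N (\<lambda>x. f x - g i x)) \<le> nsq \<mu> (\<lambda>x. f x - g i x)"
        using L f by (simp add: nsq_residual[OF e] L2_fun_diff sum_nonneg)
      finally show ?thesis using i N0[OF that] by simp
    qed
    then show "\<exists>no. \<forall>n\<ge>no. norm (nsq \<mu> (residual \<mu> e n f) - 0) < r" by auto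
  qed
  then show ?thesis using f by (simp add: parseval_set_iff[OF e])
qed

lemma nsq_tendsto_0:
  assumes h: "h \<in> L2_fun \<mu>" and f: "f \<in> borel_measurable \<mu>" and g: "\<And>i. g i \<in> borel_measurable \<mu>"
    and bd: "\<And>i x. x \<in> space \<mu> \<Longrightarrow> cmod (f x - g i x) \<le> cmod (h x)"
    and lim: "\<And>x. x \<in> space \<mu> \<Longrightarrow> (\<lambda>i. g i x) \<longlonglongrightarrow> f x"
  shows "(\<lambda>i. nsq \<mu> (\<lambda>x. f x - g i x)) \<longlonglongrightarrow> 0"
proof -
  note [measurable] = f g
  have "(\<lambda>i. \<integral>x. (cmod (f x - g i x))\<^sup>2 \<partial>\<mu>) \<longlonglongrightarrow> (\<integral>x. 0 \<partial>\<mu>)"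
  proof (rule integral_dominated_convergence[where w = "\<lambda>x. (cmod (h x))\<^sup>2"])
    show "integrable \<mu> (\<lambda>x. (cmod (h x))\<^sup>2)" using h by (simp add: L2_fun_def)
    have "(\<lambda>i. (cmod (f x - g i x))\<^sup>2) \<longlonglongrightarrow> (cmod (f x - f x))\<^sup>2" if "x \<in> space \<mu>" for x
      by (intro tendsto_intros lim that)
    then show "AE x in \<mu>. (\<lambda>i. (cmod (f x - g i x))\<^sup>2) \<longlonglongrightarrow> 0"
      by auto
    show "AE x in \<mu>. norm ((cmod (f x - g i x))\<^sup>2) \<le> (cmod (h x))\<^sup>2" for i
      using bd by (auto intro!: power_mono)
  qed auto
  then show ?thesis by (simp add: nsq_def)
qed

lemma indicator_L2_fun:
  assumes "A \<in> sets \<mu>" "emeasure \<mu> A < \<infinity>"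
  shows "(\<lambda>x. indicator A x :: complex) \<in> L2_fun \<mu>"
proof -
  have "(\<lambda>x. (cmod (indicator A x))\<^sup>2) = (indicator A :: 'a \<Rightarrow> real)"
    by (auto simp: indicator_def)
  then show ?thesis using assms by (auto simp: L2_fun_def)
qed

section \<open>A countable Parseval family in \<open>L\<^sup>2\<close>\<close>

text \<open>A pi-lambda argument. Everything is cut down by a fixed \<open>U\<close> of finite
  measure, because on a space of infinite measure the indicator of a complement can leave
  L^2.\<close>

lemma sigma_sets_indicator_in_parseval_set:
  assumes e: "orthonormal_seq \<mu> e"
    and P: "Int_stable P" "sets \<mu> = sigma_sets (space \<mu>) P"
    and fin: "\<And>A. A \<in> P \<Longrightarrow> emeasure \<mu> A < \<infinity>"
    and ind: "\<And>A. A \<in> P \<Longrightarrow> (\<lambda>x. indicator A x) \<in> parseval_set \<mu> e"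
    and A: "A \<in> sets \<mu>" and U: "U \<in> P"
  shows "(\<lambda>x. indicator (A \<inter> U) x) \<in> parseval_set \<mu> e"
proof -
  have PS: "P \<subseteq> sets \<mu>" using P(2) by (auto intro: sigma_sets.Basic)
  have PP: "P \<subseteq> Pow (space \<mu>)" using PS sets.sets_into_space by auto
  have Um: "U \<in> sets \<mu>" "U \<subseteq> space \<mu>" using U PS PP by auto
  have "A \<in> sigma_sets (space \<mu>) P" using A P(2) by simp
  with P(1) PP show ?thesis
  proof (induction A rule: sigma_sets_induct_disjoint)
    case (basic A)
    then show ?case using U P(1) by (intro ind) (auto simp: Int_stable_def)
  next
    case empty
    show ?case by (simp add: parseval_set_zero)
  next
    case (compl A)
    have "(\<lambda>x. indicator ((space \<mu> - A) \<inter> U) x :: complex)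
        = (\<lambda>x. indicator U x - indicator (A \<inter> U) x)"
      using Um by (auto simp: fun_eq_iff indicator_def)
    then show ?case using parseval_set_diff[OF e ind[OF U] compl(2)] by simp
  next
    case (union A)
    have A_meas: "A i \<in> sets \<mu>" for i using union(2) P(2) by auto
    \<comment> \<open>Disjointness turns the indicator of a finite union into a finite sum, which
      stays in the set; dominated convergence under the indicator of \<open>U\<close> then handles
      the countable union.\<close>
    define g where "g N x = (\<Sum>i<N. indicator (A i \<inter> U) x :: complex)" for N x
    have g_eq: "g N x = indicator ((\<Union>i<N. A i) \<inter> U) x" for N x
    proof -
      have "disjoint_family_on (\<lambda>i. A i \<inter> U) {..<N}"
        using union(1) by (auto simp: disjoint_family_on_def)
      then have "g N x = indicator (\<Union>i<N. A i \<inter> U) x"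
        unfolding g_def by (subst indicator_UN_disjoint) auto
      then show ?thesis by simp
    qed
    show ?case
    proof (rule parseval_set_limit[OF e])
      have f: "emeasure \<mu> U < \<infinity>" using fin U .
      have UA: "(\<Union>i. A i) \<inter> U \<in> sets \<mu>" using A_meas Um by auto
      show "(\<lambda>x. indicator ((\<Union>i. A i) \<inter> U) x) \<in> L2_fun \<mu>"
        using UA f Um by (intro indicator_L2_fun) (auto intro: le_less_trans[OF emeasure_mono])
      show "g N \<in> parseval_set \<mu> e" for N
        unfolding g_def by (intro parseval_set_sum[OF e] union)
      show "(\<lambda>N. nsq \<mu> (\<lambda>x. indicator ((\<Union>i. A i) \<inter> U) x - g N x)) \<longlonglongrightarrow> 0"
      proof (rule nsq_tendsto_0)
        show "(\<lambda>x. indicator U x) \<in> L2_fun \<mu>" using Um f by (intro indicator_L2_fun)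
        show "(\<lambda>x. indicator ((\<Union>i. A i) \<inter> U) x :: complex) \<in> borel_measurable \<mu>"
          using UA by simp
        show "g i \<in> borel_measurable \<mu>" for i
          unfolding g_eq[abs_def] using A_meas Um by (intro borel_measurable_indicator) auto
        show "cmod (indicator ((\<Union>i. A i) \<inter> U) x - g N x) \<le> cmod (indicator U x)" for N x
          by (auto simp: g_eq indicator_def)
        show "(\<lambda>N. g N x) \<longlonglongrightarrow> indicator ((\<Union>i. A i) \<inter> U) x" for x
        proof (cases "x \<in> (\<Union>i. A i) \<inter> U")
          case True
          then obtain j where "x \<in> A j" "x \<in> U" by auto
          then have "g N x = 1" if "N \<ge> Suc j" for N
            using that by (auto simp: g_eq indicator_def)
          then show ?thesis using True
            by (intro tendsto_eventually) (auto simp: eventually_sequentially)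
        next
          case False
          then show ?thesis by (auto simp: g_eq indicator_def)
        qed
      qed
    qed
  qed
qed

text \<open>The approximation runs from sets to functions: sets inside finitely many members of
  \<open>P\<close>, simple functions cut off outside these, and finally all of L^2 by dominated
  convergence.\<close>

lemma parseval_set_eq_L2_fun:
  assumes e: "orthonormal_seq \<mu> e"
    and P: "Int_stable P" "countable P" "sets \<mu> = sigma_sets (space \<mu>) P" "\<Union>P = space \<mu>"
    and fin: "\<And>A. A \<in> P \<Longrightarrow> emeasure \<mu> A < \<infinity>"
    and ind: "\<And>A. A \<in> P \<Longrightarrow> (\<lambda>x. indicator A x) \<in> parseval_set \<mu> e"
    and f: "f \<in> L2_fun \<mu>"
  shows "f \<in> parseval_set \<mu> e"
proof -
  have [measurable]: "f \<in> borel_measurable \<mu>" using f by (rule L2_fun_measurable)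
  have PS: "P \<subseteq> sets \<mu>" using P(3) by (auto intro: sigma_sets.Basic)
  show ?thesis
  \<comment> \<open>\<open>from_nat_into P\<close> enumerates \<open>P\<close> only if
    \<open>P\<close> is nonempty; an empty \<open>P\<close> forces an empty space, where every
    integral is 0.\<close>
  proof (cases "P = {}")
    case True
    then have "\<And>g. nsq \<mu> g = 0" "\<And>g h. ip \<mu> g h = 0"
      using P(4) by (simp_all add: nsq_def ip_def Bochner_Integration.integral_empty)
    then show ?thesis using f by (simp add: parseval_set_def)
  next
    case False
    define U where "U = from_nat_into P"
    have U: "U i \<in> P" for i unfolding U_def using False by (rule from_nat_into)
    have U_meas [measurable]: "U i \<in> sets \<mu>" for i using U PS by auto
    have U_cover: "(\<Union>i. U i) = space \<mu>"
      using P(4) unfolding U_def by (simp add: range_from_nat_into[OF False P(2)])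
    have ind_part: "(\<lambda>x. indicator (A \<inter> (\<Union>j<N. U j)) x) \<in> parseval_set \<mu> e"
      if A: "A \<in> sets \<mu>" for A N
    proof -
      \<comment> \<open>Disjointification: each piece lies in a single \<open>U i\<close>, where the
        preceding lemma applies, and the indicators of the pieces add up.\<close>
      let ?B = "\<lambda>i. (A - (\<Union>j<i. U j)) \<inter> U i"
      have "(\<Union>i<N. ?B i) = A \<inter> (\<Union>j<N. U j)"
        by (induction N) (auto simp: lessThan_Suc)
      moreover have "disjoint_family_on ?B {..<N}"
      proof -
        have "?B i \<inter> ?B j = {}" if "i < j" for i j using that by auto
        then show ?thesis unfolding disjoint_family_on_def by (metis Int_commute nat_neq_iff)
      qed
      ultimately have "(\<lambda>x. indicator (A \<inter> (\<Union>j<N. U j)) x :: complex)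
          = (\<lambda>x. \<Sum>i<N. indicator (?B i) x)"
        using indicator_UN_disjoint[of "{..<N}" ?B] by (auto simp: fun_eq_iff)
      also have "\<dots> \<in> parseval_set \<mu> e"
        using A by (intro parseval_set_sum[OF e] sigma_sets_indicator_in_parseval_set[OF e P(1,3) fin ind]
          U sets.Diff sets.finite_UN) auto
      finally show ?thesis .
    qed
    obtain F where F: "\<And>i. simple_function \<mu> (F i)"
        "\<And>x. x \<in> space \<mu> \<Longrightarrow> (\<lambda>i. F i x) \<longlonglongrightarrow> f x"
        "\<And>i x. x \<in> space \<mu> \<Longrightarrow> dist (F i x) 0 \<le> 2 * dist (f x) 0"
      using borel_measurable_implies_sequence_metric[OF \<open>f \<in> borel_measurable \<mu>\<close>, of 0] by blast
    \<comment> \<open>\<open>ind_part\<close> covers only sets cut by the first finitely many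
      members of \<open>P\<close>, so the simple functions are cut off there. At a given point the
      cut-off acts for finitely many \<open>i\<close> only.\<close>
    define g where "g i x = F i x * indicator (\<Union>j<i. U j) x" for i x
    have F_meas [measurable]: "F i \<in> borel_measurable \<mu>" for i
      using F(1) by (rule borel_measurable_simple_function)
    have UN_meas [measurable]: "(\<Union>j<i. U j) \<in> sets \<mu>" for i by auto
    have g_meas: "g i \<in> borel_measurable \<mu>" for i
      unfolding g_def by measurable
    have g_le: "cmod (g i x) \<le> 2 * cmod (f x)" if "x \<in> space \<mu>" for i x
      using F(3)[OF that, of i] by (auto simp: g_def indicator_def)
    show ?thesis
    proof (rule parseval_set_limit[OF e f])
      fix i
      let ?h = "\<lambda>x. \<Sum>y\<in>F i ` space \<mu>. y * indicator ({z\<in>space \<mu>. F i z = y} \<inter> (\<Union>j<i. U j)) x"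
      have h: "?h \<in> parseval_set \<mu> e"
        by (intro parseval_set_sum[OF e] parseval_set_scale ind_part) measurable
      have eq: "g i x = ?h x" if "x \<in> space \<mu>" for x
      proof -
        have "?h x = (\<Sum>y\<in>F i ` space \<mu>. if y = F i x then F i x * indicator (\<Union>j<i. U j) x else 0)"
          using that by (intro sum.cong) (auto simp: indicator_def)
        also have "\<dots> = g i x"
          using that F(1) by (simp add: g_def simple_function_def)
        finally show ?thesis ..
      qed
      have "nsq \<mu> (g i) = nsq \<mu> ?h" "\<And>k. ip \<mu> (g i) k = ip \<mu> ?h k"
        unfolding nsq_def ip_def by (auto intro!: Bochner_Integration.integral_cong simp: eq)
      moreover have "g i \<in> L2_fun \<mu>"
      proof -
        have "(\<lambda>x. 2 * f x) \<in> L2_fun \<mu>" using f by (rule L2_fun_scale)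
        then show ?thesis
          by (rule L2_fun_bound) (use g_meas g_le in \<open>auto simp: norm_mult\<close>)
      qed
      ultimately show "g i \<in> parseval_set \<mu> e"
        using h by (simp add: parseval_set_def)
    next
      show "(\<lambda>i. nsq \<mu> (\<lambda>x. f x - g i x)) \<longlonglongrightarrow> 0"
      proof (rule nsq_tendsto_0)
        \<comment> \<open>3 = 1 + 2: the size of \<open>f\<close> itself plus the factor 2 in the
          bound for the approximating simple functions.\<close>
        show "(\<lambda>x. 3 * f x) \<in> L2_fun \<mu>" using f by (rule L2_fun_scale)
        show "cmod (f x - g i x) \<le> cmod (3 * f x)" if "x \<in> space \<mu>" for i x
          using norm_triangle_ineq4[of "f x" "g i x"] g_le[OF that, of i] by (simp add: norm_mult)
        show "(\<lambda>i. g i x) \<longlonglongrightarrow> f x" if x: "x \<in> space \<mu>" for x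
        proof -
          obtain j where "x \<in> U j" using x U_cover by auto
          then have "F i x = g i x" if "i \<ge> Suc j" for i
            using that by (auto simp: g_def indicator_def)
          then have "eventually (\<lambda>i. F i x = g i x) sequentially"
            by (auto simp: eventually_sequentially)
          then show ?thesis by (rule Lim_transform_eventually[OF F(2)[OF x]])
        qed
      qed (use g_meas in auto)
    qed
  qed
qed

text \<open>This is separability of L^2: Gram-Schmidt is run on the indicators of the countably many
  generators.\<close>

lemma L2_parseval_seq_exists:
  assumes P: "Int_stable P" "countable P" "sets \<mu> = sigma_sets (space \<mu>) P" "\<Union>P = space \<mu>"
    and fin: "\<And>A. A \<in> P \<Longrightarrow> emeasure \<mu> A < \<infinity>"
  obtains e where "orthonormal_seq \<mu> e" "parseval_set \<mu> e = L2_fun \<mu>"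
proof -
  \<comment> \<open>Adding the empty set gives a valid enumeration even for empty \<open>P\<close>;
    it contributes the zero function.\<close>
  define A where "A = from_nat_into (insert {} P)"
  define d where "d n x = (indicator (A n) x :: complex)" for n x
  have PS: "P \<subseteq> sets \<mu>" using P(3) by (auto intro: sigma_sets.Basic)
  have AP: "A n \<in> insert {} P" for n unfolding A_def by (rule from_nat_into) simp
  have fin': "B \<in> sets \<mu>" "emeasure \<mu> B < \<infinity>" if "B \<in> insert {} P" for B
    using PS fin that by auto
  note A = fin'[OF AP]
  have rA: "range A = insert {} P"
    unfolding A_def using P(2) by (intro range_from_nat_into) auto
  have d: "d n \<in> L2_fun \<mu>" for n
    unfolding d_def using A by (intro indicator_L2_fun)
  let ?e = "gram_schmidt \<mu> d"
  have on: "orthonormal_seq \<mu> ?e" by (rule orthonormal_gram_schmidt[OF d])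
  have "(\<lambda>x. indicator V x) \<in> parseval_set \<mu> ?e" if "V \<in> P" for V
  proof -
    have "V \<in> range A" unfolding rA using that by simp
    then obtain n where "V = A n" by blast
    then have "(\<lambda>x. indicator V x) = d n" by (simp add: d_def fun_eq_iff)
    then show ?thesis using gram_schmidt_in_parseval_set[of d \<mu> n, OF d] by simp
  qed
  then have "L2_fun \<mu> \<subseteq> parseval_set \<mu> ?e"
    using parseval_set_eq_L2_fun[OF on P fin] by blast
  then have "parseval_set \<mu> ?e = L2_fun \<mu>" by (auto simp: parseval_set_def)
  with on show ?thesis by (rule that)
qed

section \<open>Completeness and the Riesz representation theorem\<close>

lemma L2_fun_nn_integral:
  assumes "f \<in> borel_measurable \<mu>"
  shows "f \<in> L2_fun \<mu> \<longleftrightarrow> (\<integral>\<^sup>+x. ennreal ((cmod (f x))\<^sup>2) \<partial>\<mu>) < \<infinity>"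
  using assms by (auto simp: L2_fun_def integrable_iff_bounded)

lemma nn_integral_eq_nsq:
  assumes "f \<in> L2_fun \<mu>"
  shows "(\<integral>\<^sup>+x. ennreal ((cmod (f x))\<^sup>2) \<partial>\<mu>) = ennreal (nsq \<mu> f)"
  using assms unfolding nsq_def by (intro nn_integral_eq_integral) (auto simp: L2_fun_def)

text \<open>With distances \<open>u\<^sub>k\<close> of size \<open>2\<^sup>-\<^sup>k\<close> in norm, \<open>u\<^sub>k \<le> 2\<^sup>-\<^sup>k + 2\<^sup>k u\<^sub>k\<^sup>2\<close> pointwise and the right-hand side
  is almost everywhere summable; this avoids Minkowski's inequality.\<close>

lemma L2_fast_cauchy_AE_convergent:
  assumes s: "\<And>k. s k \<in> L2_fun \<mu>" and le: "\<And>k. nsq \<mu> (\<lambda>x. s (Suc k) x - s k x) \<le> (1/4) ^ k"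
  shows "AE x in \<mu>. convergent (\<lambda>k. s k x)"
proof -
  define u where "u k x = cmod (s (Suc k) x - s k x)" for k x
  have sm [measurable]: "s k \<in> borel_measurable \<mu>" for k using s by (simp add: L2_fun_def)
  have um [measurable]: "u k \<in> borel_measurable \<mu>" for k unfolding u_def by measurable
  have int: "(\<integral>\<^sup>+x. ennreal (2^k * (u k x)\<^sup>2) \<partial>\<mu>) \<le> ennreal ((1/2)^k)" for k
  proof -
    have "(\<integral>\<^sup>+x. ennreal (2^k * (u k x)\<^sup>2) \<partial>\<mu>) = ennreal (2^k) * ennreal (nsq \<mu> (\<lambda>x. s (Suc k) x - s k x))"
      unfolding u_def using nn_integral_eq_nsq[OF L2_fun_diff[OF s s], of "Suc k" k]
      by (simp add: ennreal_mult nn_integral_cmult)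
    also have "\<dots> \<le> ennreal (2^k) * ennreal ((1/4)^k)"
      by (intro mult_left_mono ennreal_leI le) simp
    also have "\<dots> = ennreal ((1/2)^k)"
      by (simp flip: ennreal_mult power_mult_distrib)
    finally show ?thesis .
  qed
  have "(\<integral>\<^sup>+x. (\<Sum>k. ennreal (2^k * (u k x)\<^sup>2)) \<partial>\<mu>) = (\<Sum>k. \<integral>\<^sup>+x. ennreal (2^k * (u k x)\<^sup>2) \<partial>\<mu>)"
    by (intro nn_integral_suminf) measurable
  also have "\<dots> \<le> (\<Sum>k. ennreal ((1/2)^k))"
    by (intro suminf_le int) auto
  also have "\<dots> = ennreal 2"
    using sums_unique[OF geometric_sums[of "1/2::real"]]
    by (subst suminf_ennreal2) (auto simp: summable_geometric)
  finally have "(\<integral>\<^sup>+x. (\<Sum>k. ennreal (2^k * (u k x)\<^sup>2)) \<partial>\<mu>) < \<infinity>"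
    by (rule le_less_trans) simp
  then have "AE x in \<mu>. (\<Sum>k. ennreal (2^k * (u k x)\<^sup>2)) \<noteq> \<infinity>"
    by (intro nn_integral_PInf_AE borel_measurable_suminf_order) auto
  then show ?thesis
  proof eventually_elim
    case (elim x)
    have "summable (\<lambda>k. 2^k * (u k x)\<^sup>2)"
      using elim by (intro summable_suminf_not_top) auto
    then have sum: "summable (\<lambda>k. (1/2)^k + 2^k * (u k x)\<^sup>2)"
      by (intro summable_add summable_geometric) auto
    have "u k x \<le> (1/2)^k + 2^k * (u k x)\<^sup>2" for k
    proof -
      \<comment> \<open>Expanding this square bounds \<open>2 * u k x\<close> by the desired sum;
        the products \<open>(2 * (1/2))^k\<close> are 1.\<close>
      have "0 \<le> 2^k * (u k x - (1/2)^k)\<^sup>2" by simp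
      also have "\<dots> = 2^k * (u k x)\<^sup>2 - 2 * (2 * (1/2))^k * u k x + (2 * (1/2))^k * (1/2)^k"
        unfolding power_mult_distrib by (simp add: power2_eq_square algebra_simps)
      finally have "2 * u k x \<le> (1/2)^k + 2^k * (u k x)\<^sup>2" by simp
      moreover have "0 \<le> u k x" by (simp add: u_def)
      ultimately show ?thesis by linarith
    qed
    then have "summable (\<lambda>k. s (Suc k) x - s k x)"
      by (intro summable_comparison_test'[OF sum]) (simp add: u_def)
    then have "(\<lambda>n. \<Sum>k<n. s (Suc k) x - s k x) \<longlonglongrightarrow> (\<Sum>k. s (Suc k) x - s k x)"
      by (rule summable_LIMSEQ)
    then have "(\<lambda>n. s n x - s 0 x) \<longlonglongrightarrow> (\<Sum>k. s (Suc k) x - s k x)"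
      unfolding sum_lessThan_telescope[of "\<lambda>k. s k x"] .
    from tendsto_add[OF this tendsto_const[of "s 0 x"]] show ?case
      by (auto simp: convergent_def)
  qed
qed

text \<open>The Riesz-Fischer argument: a fast subsequence converges almost everywhere, and Fatou's
  lemma along it compares every late \<open>s m\<close>, not just those of the subsequence, with the
  limit.\<close>

lemma L2_complete:
  assumes s: "\<And>k. s k \<in> L2_fun \<mu>"
    and cauchy: "\<And>r. r > 0 \<Longrightarrow> \<exists>N. \<forall>m\<ge>N. \<forall>n\<ge>N. nsq \<mu> (\<lambda>x. s m x - s n x) \<le> r"
  obtains g where "g \<in> L2_fun \<mu>" "(\<lambda>k. nsq \<mu> (\<lambda>x. s k x - g x)) \<longlonglongrightarrow> 0"
proof -
  have sm [measurable]: "s k \<in> borel_measurable \<mu>" for k using s by (simp add: L2_fun_def)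
  obtain M where M: "\<And>r m n. r > 0 \<Longrightarrow> m \<ge> M r \<Longrightarrow> n \<ge> M r \<Longrightarrow> nsq \<mu> (\<lambda>x. s m x - s n x) \<le> r"
    using cauchy by metis
  \<comment> \<open>The sum makes \<open>N\<close> increasing and lifts it above each required
    threshold; the summand \<open>k\<close> makes it tend to infinity.\<close>
  define N where "N k = k + (\<Sum>i\<le>k. M ((1/4)^i))" for k
  have N_ge: "M ((1/4)^k) \<le> N k" "k \<le> N k" for k
  proof -
    have "M ((1/4)^k) \<le> (\<Sum>i\<le>k. M ((1/4)^i))" by (rule member_le_sum) auto
    then show "M ((1/4)^k) \<le> N k" "k \<le> N k" by (auto simp: N_def)
  qed
  have N_mono: "N k \<le> N (Suc k)" for k by (simp add: N_def)
  have le: "nsq \<mu> (\<lambda>x. s (N (Suc k)) x - s (N k) x) \<le> (1/4)^k" for k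
    using N_ge(1)[of k] N_mono[of k] by (intro M) auto
  \<comment> \<open>On the null set of divergence \<open>lim\<close> has some unspecified value;
    \<open>g\<close> is measurable all the same.\<close>
  define g where "g x = lim (\<lambda>k. s (N k) x)" for x
  have gm [measurable]: "g \<in> borel_measurable \<mu>"
    unfolding g_def by (intro borel_measurable_lim_metric) measurable
  have conv: "AE x in \<mu>. (\<lambda>k. s (N k) x) \<longlonglongrightarrow> g x"
    using L2_fast_cauchy_AE_convergent[of "\<lambda>k. s (N k)", OF s le]
    by eventually_elim (simp add: g_def convergent_LIMSEQ_iff)
  have fatou: "(\<integral>\<^sup>+x. ennreal ((cmod (s m x - g x))\<^sup>2) \<partial>\<mu>) \<le> ennreal r"
    if r: "r > 0" and m: "m \<ge> M r" for m r
  proof -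
    have "AE x in \<mu>. liminf (\<lambda>k. ennreal ((cmod (s m x - s (N k) x))\<^sup>2)) = ennreal ((cmod (s m x - g x))\<^sup>2)"
      using conv
    proof eventually_elim
      case (elim x)
      then have "(\<lambda>k. ennreal ((cmod (s m x - s (N k) x))\<^sup>2)) \<longlonglongrightarrow> ennreal ((cmod (s m x - g x))\<^sup>2)"
        by (intro tendsto_intros tendsto_ennrealI)
      then show ?case by (intro lim_imp_Liminf) auto
    qed
    then have "(\<integral>\<^sup>+x. ennreal ((cmod (s m x - g x))\<^sup>2) \<partial>\<mu>)
        = (\<integral>\<^sup>+x. liminf (\<lambda>k. ennreal ((cmod (s m x - s (N k) x))\<^sup>2)) \<partial>\<mu>)"
      by (intro nn_integral_cong_AE) auto
    also have "\<dots> \<le> liminf (\<lambda>k. \<integral>\<^sup>+x. ennreal ((cmod (s m x - s (N k) x))\<^sup>2) \<partial>\<mu>)"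
      by (rule nn_integral_liminf) measurable
    also have "\<dots> \<le> ennreal r"
    proof (rule Liminf_le)
      show "\<forall>\<^sub>F k in sequentially. (\<integral>\<^sup>+x. ennreal ((cmod (s m x - s (N k) x))\<^sup>2) \<partial>\<mu>) \<le> ennreal r"
      proof (rule eventually_sequentiallyI[of "M r"])
        fix k assume "M r \<le> k"
        then have "M r \<le> N k" using N_ge(2)[of k] by simp
        then show "(\<integral>\<^sup>+x. ennreal ((cmod (s m x - s (N k) x))\<^sup>2) \<partial>\<mu>) \<le> ennreal r"
          unfolding nn_integral_eq_nsq[OF L2_fun_diff[OF s s]] using M r m by (intro ennreal_leI) auto
      qed
    qed simp
    finally show ?thesis .
  qed
  have diff: "(\<lambda>x. s m x - g x) \<in> L2_fun \<mu>" if "m \<ge> M 1" for m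
    using fatou[of 1 m] that by (subst L2_fun_nn_integral) (auto simp: le_less_trans)
  \<comment> \<open>\<open>g\<close> is \<open>s (M 1)\<close> minus the square integrable
    difference of \<open>s (M 1)\<close> and \<open>g\<close>.\<close>
  have g: "g \<in> L2_fun \<mu>"
    using L2_fun_diff[OF s diff, of "M 1" "M 1"] by simp
  have "(\<lambda>k. nsq \<mu> (\<lambda>x. s k x - g x)) \<longlonglongrightarrow> 0"
  proof (rule LIMSEQ_I)
    fix r :: real assume r: "0 < r"
    have "nsq \<mu> (\<lambda>x. s m x - g x) < r" if "m \<ge> M (r/2)" for m
      using fatou[of "r/2" m] that r by (simp add: nn_integral_eq_nsq L2_fun_diff s g)
    then show "\<exists>no. \<forall>n\<ge>no. norm (nsq \<mu> (\<lambda>x. s n x - g x) - 0) < r" by auto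
  qed
  with g show ?thesis by (rule that)
qed

section \<open>Bounded linear functionals on L^2\<close>

lemma ip_tendsto_right:
  assumes "f \<in> L2_fun \<mu>" "\<And>k. s k \<in> L2_fun \<mu>" "g \<in> L2_fun \<mu>"
    and lim: "(\<lambda>k. nsq \<mu> (\<lambda>x. s k x - g x)) \<longlonglongrightarrow> 0"
  shows "(\<lambda>k. ip \<mu> f (s k)) \<longlonglongrightarrow> ip \<mu> f g"
proof -
  have "cmod (ip \<mu> f (s k) - ip \<mu> f g) \<le> sqrt (nsq \<mu> f * nsq \<mu> (\<lambda>x. s k x - g x))" for k
    using cauchy_schwarz[OF assms(1) L2_fun_diff[OF assms(2,3)], of k]
    by (intro real_le_rsqrt) (simp add: ip_diff_right assms)
  then have "\<forall>\<^sub>F k in sequentially. cmod (ip \<mu> f (s k) - ip \<mu> f g)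
      \<le> sqrt (nsq \<mu> f * nsq \<mu> (\<lambda>x. s k x - g x))"
    by (intro always_eventually allI)
  moreover have "(\<lambda>k. sqrt (nsq \<mu> f * nsq \<mu> (\<lambda>x. s k x - g x))) \<longlonglongrightarrow> 0"
    using tendsto_real_sqrt[OF tendsto_mult_left[OF lim, of "nsq \<mu> f"]] by simp
  ultimately have "(\<lambda>k. ip \<mu> f (s k) - ip \<mu> f g) \<longlonglongrightarrow> 0"
    by (rule Lim_null_comparison)
  then show ?thesis by (rule LIM_zero_cancel)
qed

text \<open>Only an inequality, as zero vectors are allowed in \<open>e\<close> and their
  coefficients are arbitrary.\<close>

lemma nsq_sum_orthonormal:
  assumes e: "orthonormal_seq \<mu> e" and I: "finite I"
  shows "nsq \<mu> (\<lambda>x. \<Sum>k\<in>I. c k * e k x) \<le> (\<Sum>k\<in>I. (cmod (c k))\<^sup>2)"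
  using I
proof (induction I rule: finite_induct)
  case empty
  show ?case by (simp add: nsq_def)
next
  case (insert j I)
  have eL: "e k \<in> L2_fun \<mu>" for k using e by (simp add: orthonormal_seq_def)
  \<comment> \<open>The sign in \<open>?j\<close> turns the sum into a difference, to which
    \<open>nsq_diff\<close> applies.\<close>
  let ?s = "\<lambda>x. \<Sum>k\<in>I. c k * e k x" and ?j = "\<lambda>x. (- c j) * e j x"
  have sL: "?s \<in> L2_fun \<mu>" "?j \<in> L2_fun \<mu>" by (intro L2_fun_sum L2_fun_scale eL)+
  have "ip \<mu> ?s (e j) = (\<Sum>k\<in>I. c k * ip \<mu> (e k) (e j))"
    by (subst ip_sum_left) (auto simp: ip_scale_left eL L2_fun_scale)
  also have "\<dots> = 0"
  proof (rule sum.neutral, rule ballI)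
    fix k assume "k \<in> I"
    then have "k \<noteq> j" using insert.hyps by auto
    then show "c k * ip \<mu> (e k) (e j) = 0" using e by (simp add: orthonormal_seq_def)
  qed
  finally have "ip \<mu> ?s ?j = 0" by (simp only: ip_scale_right mult_zero_right)
  then have "nsq \<mu> (\<lambda>x. ?s x - ?j x) = nsq \<mu> ?s + nsq \<mu> ?j"
    using nsq_diff[OF sL] by simp
  also have "nsq \<mu> ?j \<le> (cmod (c j))\<^sup>2"
  proof -
    have "nsq \<mu> (e j) \<le> 1" using e unfolding orthonormal_seq_def by (auto dest!: spec[of _ j])
    then show ?thesis
      unfolding nsq_scale by (simp add: mult_left_le)
  qed
  finally show ?case using insert by (simp add: add.commute)
qed

text \<open>If \<open>l\<close> is represented by \<open>\<phi>\<close>, the coefficients of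
  \<open>\<phi>\<close> along \<open>e\<close> have to be \<open>cnj (l (e k))\<close>. Boundedness
  makes these square summable, completeness sums the series, and Parseval extends the identity from
  the span to all functions.\<close>

lemma riesz_L2:
  assumes e: "orthonormal_seq \<mu> e" "parseval_set \<mu> e = L2_fun \<mu>"
    and add: "\<And>f g. f \<in> L2_fun \<mu> \<Longrightarrow> g \<in> L2_fun \<mu> \<Longrightarrow> l (\<lambda>x. f x + g x) = l f + l g"
    and scale: "\<And>c f. f \<in> L2_fun \<mu> \<Longrightarrow> l (\<lambda>x. c * f x) = c * l f"
    and bd: "\<And>f. f \<in> L2_fun \<mu> \<Longrightarrow> (cmod (l f))\<^sup>2 \<le> C * nsq \<mu> f"
  obtains \<phi> where "\<phi> \<in> L2_fun \<mu>" "\<And>f. f \<in> L2_fun \<mu> \<Longrightarrow> l f = ip \<mu> f \<phi>"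
proof -
  have eL: "e k \<in> L2_fun \<mu>" for k using e by (simp add: orthonormal_seq_def)
  have zero: "l (\<lambda>x. 0) = 0" using scale[OF L2_fun_zero, of 0] by simp
  have lsum: "l (\<lambda>x. \<Sum>k<N. c k * e k x) = (\<Sum>k<N. c k * l (e k))" for c and N :: nat
  proof (induction N)
    case (Suc N)
    then show ?case
      by (simp add: add L2_fun_sum L2_fun_scale eL scale)
  qed (simp add: zero)
  define a where "a k = cnj (l (e k))" for k
  define s where "s N x = (\<Sum>k<N. a k * e k x)" for N :: nat and x
  have sL: "s N \<in> L2_fun \<mu>" for N unfolding s_def by (intro L2_fun_sum L2_fun_scale eL)
  \<comment> \<open>Testing \<open>l\<close> on the partial sum \<open>s N\<close> gives
    \<open>S\<^sup>2 \<le> \<bar>C\<bar> * S\<close> for the sum of squares \<open>S\<close>, hence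
    \<open>S \<le> \<bar>C\<bar>\<close>.\<close>
  have a_bound: "(\<Sum>k<N. (cmod (a k))\<^sup>2) \<le> \<bar>C\<bar>" for N
  proof -
    let ?S = "\<Sum>k<N. (cmod (a k))\<^sup>2"
    have S: "0 \<le> ?S" by (intro sum_nonneg) simp
    have "l (s N) = of_real ?S"
      unfolding s_def lsum by (simp add: a_def complex_norm_square mult.commute del: of_real_power)
    then have "?S\<^sup>2 = (cmod (l (s N)))\<^sup>2" by (simp del: of_real_sum)
    also have "\<dots> \<le> C * nsq \<mu> (s N)" by (rule bd[OF sL])
    also have "\<dots> \<le> \<bar>C\<bar> * nsq \<mu> (s N)" by (intro mult_right_mono) auto
    also have "\<dots> \<le> \<bar>C\<bar> * ?S"
      unfolding s_def by (intro mult_left_mono nsq_sum_orthonormal e) auto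
    finally show ?thesis
      using S by (cases "?S = 0") (auto simp: power2_eq_square mult_le_cancel_right)
  qed
  have summ: "summable (\<lambda>k. (cmod (a k))\<^sup>2)"
    by (rule bounded_imp_summable[of _ "\<bar>C\<bar>"]) (simp, metis a_bound lessThan_Suc_atMost)
  have s_diff: "nsq \<mu> (\<lambda>x. s n x - s m x) \<le> (\<Sum>k=m..<n. (cmod (a k))\<^sup>2)" if "m \<le> n" for m n
  proof -
    have "s n x - s m x = (\<Sum>k=m..<n. a k * e k x)" for x
      using sum_diff_nat_ivl[of 0 m n "\<lambda>k. a k * e k x"] that by (simp add: s_def atLeast0LessThan)
    then show ?thesis using nsq_sum_orthonormal[OF e(1), of "{m..<n}" a] by simp
  qed
  have "\<exists>N. \<forall>m\<ge>N. \<forall>n\<ge>N. nsq \<mu> (\<lambda>x. s m x - s n x) \<le> r" if r: "r > 0" for r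
  proof -
    obtain N where N: "\<And>m n. m \<ge> N \<Longrightarrow> norm (\<Sum>k=m..<n. (cmod (a k))\<^sup>2) < r"
      using summ r unfolding summable_Cauchy by metis
    have le: "nsq \<mu> (\<lambda>x. s n x - s m x) \<le> r" if "N \<le> m" "m \<le> n" for m n
      using s_diff[OF that(2)] N[OF that(1), of n] by simp
    have "nsq \<mu> (\<lambda>x. s m x - s n x) \<le> r" if "N \<le> m" "N \<le> n" for m n
      using that le[of m n] le[of n m] nsq_diff_commute[of \<mu> "s m" "s n"] by (cases "m \<le> n") auto
    then show ?thesis by blast
  qed
  from L2_complete[of s \<mu>, OF sL this] obtain \<phi> where
    \<phi>: "\<phi> \<in> L2_fun \<mu>" "(\<lambda>k. nsq \<mu> (\<lambda>x. s k x - \<phi> x)) \<longlonglongrightarrow> 0" by blast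
  have "l f = ip \<mu> f \<phi>" if f: "f \<in> L2_fun \<mu>" for f
  proof -
    have lim1: "(\<lambda>N. ip \<mu> f (s N)) \<longlonglongrightarrow> ip \<mu> f \<phi>"
      by (rule ip_tendsto_right[OF f sL \<phi>])
    have ip_s: "ip \<mu> f (s N) = (\<Sum>k<N. ip \<mu> f (e k) * l (e k))" for N
    proof -
      have "ip \<mu> (s N) f = (\<Sum>k<N. a k * ip \<mu> (e k) f)"
        unfolding s_def by (subst ip_sum_left) (auto simp: ip_scale_left eL L2_fun_scale f)
      then show ?thesis
        by (subst ip_commute) (simp add: a_def ip_commute[of \<mu> "e _" f] mult.commute)
    qed
    \<comment> \<open>The difference is the value of \<open>l\<close> at the residual of
      \<open>f\<close>, so the bound on \<open>l\<close> applies.\<close>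
    have le: "(cmod (l f - ip \<mu> f (s N)))\<^sup>2 \<le> \<bar>C\<bar> * nsq \<mu> (residual \<mu> e N f)" for N
    proof -
      have "l f = l (\<lambda>x. residual \<mu> e N f x + (\<Sum>k<N. ip \<mu> f (e k) * e k x))"
        by (simp add: residual_def)
      also have "\<dots> = l (residual \<mu> e N f) + ip \<mu> f (s N)"
        unfolding ip_s lsum[symmetric]
        by (intro add residual_L2_fun L2_fun_sum L2_fun_scale eL f)
      finally have "(cmod (l f - ip \<mu> f (s N)))\<^sup>2 \<le> C * nsq \<mu> (residual \<mu> e N f)"
        using bd[OF residual_L2_fun[of N e \<mu> f]] eL f by simp
      also have "\<dots> \<le> \<bar>C\<bar> * nsq \<mu> (residual \<mu> e N f)" by (intro mult_right_mono) auto
      finally show ?thesis .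
    qed
    have "(\<lambda>N. nsq \<mu> (residual \<mu> e N f)) \<longlonglongrightarrow> 0"
      using f e by (metis parseval_set_iff)
    from tendsto_mult_left[OF this, of "\<bar>C\<bar>"]
    have lim2: "(\<lambda>N. \<bar>C\<bar> * nsq \<mu> (residual \<mu> e N f)) \<longlonglongrightarrow> 0"
      by simp
    have "(\<lambda>N. (cmod (l f - ip \<mu> f (s N)))\<^sup>2) \<longlonglongrightarrow> 0"
      by (rule Lim_null_comparison[OF always_eventually lim2]) (simp add: le)
    then have "(\<lambda>N. l f - ip \<mu> f (s N)) \<longlonglongrightarrow> 0"
      by (simp add: tendsto_norm_zero_iff)
    then have "(\<lambda>N. ip \<mu> f (s N)) \<longlonglongrightarrow> l f"
      using tendsto_diff[OF tendsto_const[of "l f"], of "\<lambda>N. l f - ip \<mu> f (s N)" 0] by simp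
    from LIMSEQ_unique[OF this lim1] show ?thesis .
  qed
  with \<phi>(1) show ?thesis by (rule that)
qed

section \<open>Borel measures on second countable locally compact spaces\<close>

text \<open>Split off from \<open>left_haar_measure\<close> so that the measurability lemmas serve
  the group, the subgroup with its subspace topology, and maps between them.\<close>

definition borel_on :: "'a topology \<Rightarrow> 'a measure \<Rightarrow> bool" where
  "borel_on X M \<longleftrightarrow> space M = topspace X \<and> sets M = sigma_sets (topspace X) {U. openin X U}"

lemma left_haar_measure_borel_on: "left_haar_measure G T \<mu> \<Longrightarrow> borel_on T \<mu>"
  by (simp add: left_haar_measure_def borel_on_def)

lemma borel_on_openin: "borel_on X M \<Longrightarrow> openin X U \<Longrightarrow> U \<in> sets M"
  by (auto simp: borel_on_def intro: sigma_sets.Basic)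

lemma borel_on_closedin:
  assumes "borel_on X M" "closedin X C"
  shows "C \<in> sets M"
proof -
  have "space M - (topspace X - C) \<in> sets M"
    using assms by (intro sets.compl_sets borel_on_openin) auto
  moreover have "space M - (topspace X - C) = C"
    using assms closedin_subset[OF assms(2)] by (auto simp: borel_on_def)
  ultimately show ?thesis by simp
qed

lemma borel_on_compactin: "borel_on X M \<Longrightarrow> Hausdorff_space X \<Longrightarrow> compactin X K \<Longrightarrow> K \<in> sets M"
  by (intro borel_on_closedin compactin_imp_closedin)

text \<open>In a product of second countable spaces an open set is a countable union of open
  rectangles. This is what makes group multiplication measurable for the product sigma-algebra, on
  which Tonelli's theorem works.\<close>

lemma openin_prod_in_pair_measure:
  assumes X: "second_countable X" and Y: "second_countable Y"
    and M: "borel_on X M" and N: "borel_on Y N" and W: "openin (prod_topology X Y) W"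
  shows "W \<in> sets (M \<Otimes>\<^sub>M N)"
proof -
  obtain B where B: "countable B" "\<And>V. V \<in> B \<Longrightarrow> openin X V"
      "\<And>U x. openin X U \<Longrightarrow> x \<in> U \<Longrightarrow> \<exists>V\<in>B. x \<in> V \<and> V \<subseteq> U"
    using X unfolding second_countable_def by metis
  obtain C where C: "countable C" "\<And>V. V \<in> C \<Longrightarrow> openin Y V"
      "\<And>U x. openin Y U \<Longrightarrow> x \<in> U \<Longrightarrow> \<exists>V\<in>C. x \<in> V \<and> V \<subseteq> U"
    using Y unfolding second_countable_def by metis
  define D where "D = {p \<in> B \<times> C. fst p \<times> snd p \<subseteq> W}"
  have D: "countable D"
    unfolding D_def using B(1) C(1) by (intro countable_subset[OF _ countable_SIGMA[OF B(1), of "\<lambda>_. C"]]) auto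
  have "W \<subseteq> (\<Union>p\<in>D. fst p \<times> snd p)"
  proof
    fix z assume z: "z \<in> W"
    obtain x y where xy: "z = (x, y)" by (cases z)
    obtain U V where UV: "openin X U" "openin Y V" "x \<in> U" "y \<in> V" "U \<times> V \<subseteq> W"
      using W[unfolded openin_prod_topology_alt, rule_format, OF z[unfolded xy]] by (elim exE conjE)
    obtain U' where U': "U' \<in> B" "x \<in> U'" "U' \<subseteq> U" using B(3)[OF UV(1,3)] by blast
    obtain V' where V': "V' \<in> C" "y \<in> V'" "V' \<subseteq> V" using C(3)[OF UV(2,4)] by blast
    have "U' \<times> V' \<subseteq> W" using order_trans[OF Sigma_mono[OF U'(3) V'(3)] UV(5)] .
    then have "(U', V') \<in> D" using U'(1) V'(1) by (simp add: D_def)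
    then show "z \<in> (\<Union>p\<in>D. fst p \<times> snd p)" using U'(2) V'(2) xy by (intro UN_I[of "(U', V')"]) auto
  qed
  then have "W = (\<Union>p\<in>D. fst p \<times> snd p)" by (auto simp: D_def)
  also have "\<dots> \<in> sets (M \<Otimes>\<^sub>M N)"
  proof (intro sets.countable_UN'' D)
    fix p assume "p \<in> D"
    then have "openin X (fst p)" "openin Y (snd p)" using B(2) C(2) by (auto simp: D_def)
    then show "fst p \<times> snd p \<in> sets (M \<Otimes>\<^sub>M N)"
      using borel_on_openin[OF M] borel_on_openin[OF N] by (intro pair_measureI)
  qed
  finally show ?thesis .
qed

lemma continuous_map_measurable:
  assumes "borel_on X M" "borel_on Y N" "continuous_map X Y f"
  shows "f \<in> measurable M N"
proof (rule measurable_sigma_sets)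
  show "sets N = sigma_sets (topspace Y) {U. openin Y U}" using assms by (simp add: borel_on_def)
  show "{U. openin Y U} \<subseteq> Pow (topspace Y)" using openin_subset by auto
  show "f \<in> space M \<rightarrow> topspace Y"
    using assms by (auto simp: borel_on_def continuous_map_def)
  fix U assume "U \<in> {U. openin Y U}"
  then have "openin X {x \<in> topspace X. f x \<in> U}" using assms by (simp add: continuous_map_def)
  moreover have "{x \<in> topspace X. f x \<in> U} = f -` U \<inter> space M" using assms by (auto simp: borel_on_def)
  ultimately show "f -` U \<inter> space M \<in> sets M" using borel_on_openin[OF assms(1)] by metis
qed

lemma continuous_map_prod_measurable:
  assumes "second_countable X" "second_countable Y" "borel_on X M" "borel_on Y N" "borel_on Z L"
    and f: "continuous_map (prod_topology X Y) Z f"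
  shows "f \<in> measurable (M \<Otimes>\<^sub>M N) L"
proof (rule measurable_sigma_sets)
  have sp: "space (M \<Otimes>\<^sub>M N) = topspace (prod_topology X Y)"
    using assms by (simp add: borel_on_def space_pair_measure)
  show "sets L = sigma_sets (topspace Z) {U. openin Z U}" using assms by (simp add: borel_on_def)
  show "{U. openin Z U} \<subseteq> Pow (topspace Z)" using openin_subset by auto
  show "f \<in> space (M \<Otimes>\<^sub>M N) \<rightarrow> topspace Z"
    using f unfolding sp by (auto simp: continuous_map_def)
  fix U assume "U \<in> {U. openin Z U}"
  then have "openin (prod_topology X Y) {x \<in> topspace (prod_topology X Y). f x \<in> U}"
    using f by (simp add: continuous_map_def)
  moreover have "{x \<in> topspace (prod_topology X Y). f x \<in> U} = f -` U \<inter> space (M \<Otimes>\<^sub>M N)"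
    using sp by auto
  ultimately show "f -` U \<inter> space (M \<Otimes>\<^sub>M N) \<in> sets (M \<Otimes>\<^sub>M N)"
    using openin_prod_in_pair_measure[OF assms(1-4)] by metis
qed

text \<open>Local compactness gives a cover by relatively compact open sets, the Lindelof property a
  countable subcover. Such covers later yield sigma-finiteness and the building blocks of the
  weight.\<close>

lemma countable_relatively_compact_cover:
  fixes X :: "'a topology"
  assumes "second_countable X" "locally_compact_space X"
  obtains U K :: "nat \<Rightarrow> 'a set" where
    "\<And>n. openin X (U n)" "\<And>n. compactin X (K n)" "\<And>n. U n \<subseteq> K n" "(\<Union>n. U n) = topspace X"
proof -
  let ?\<U> = "{U. openin X U \<and> (\<exists>K. compactin X K \<and> U \<subseteq> K)}"
  have "\<Union>?\<U> = topspace X"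
  proof
    show "\<Union>?\<U> \<subseteq> topspace X" using openin_subset by blast
    show "topspace X \<subseteq> \<Union>?\<U>" using assms(2) unfolding locally_compact_space_def by blast
  qed
  moreover have "Lindelof_space X" using assms(1) by (rule second_countable_imp_Lindelof_space)
  ultimately obtain V where V: "countable V" "V \<subseteq> ?\<U>" "\<Union>V = topspace X"
    unfolding Lindelof_space_def by (metis (no_types, lifting) mem_Collect_eq)
  define U where "U = from_nat_into (insert {} V)"
  have "U n \<in> insert {} V" for n unfolding U_def by (rule from_nat_into) simp
  then have "U n \<in> ?\<U>" for n using V(2) by (metis (mono_tags, lifting) compactin_empty empty_subsetI
        insertE mem_Collect_eq openin_empty subsetD)
  then have "\<exists>K. \<forall>n. openin X (U n) \<and> compactin X (K n) \<and> U n \<subseteq> (K n)"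
    by (intro choice allI) blast
  moreover have "(\<Union>n. U n) = topspace X"
    using V(3) range_from_nat_into[of "insert {} V"] V(1) by (simp add: U_def)
  ultimately show ?thesis using that by blast
qed

lemma sigma_finite_measure_lc:
  fixes X :: "'a topology"
  assumes X: "second_countable X" "locally_compact_space X" "Hausdorff_space X"
    and M: "borel_on X M" and fin: "\<And>K. compactin X K \<Longrightarrow> emeasure M K < \<infinity>"
  shows "sigma_finite_measure M"
proof -
  obtain U K :: "nat \<Rightarrow> 'a set" where UK: "\<And>n. openin X (U n)" "\<And>n. compactin X (K n)"
      "\<And>n. U n \<subseteq> K n" "(\<Union>n. U n) = topspace X"
    using countable_relatively_compact_cover[OF X(1,2)] by blast
  have "K n \<in> sets M" for n using borel_on_compactin[OF M X(3) UK(2)] .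
  moreover have "\<Union>(range K) = space M"
  proof -
    have "K n \<subseteq> topspace X" for n using compactin_subset_topspace[OF UK(2)] .
    moreover have "(\<Union>n. U n) \<subseteq> (\<Union>n. K n)" by (rule UN_mono[OF order_refl UK(3)])
    ultimately have "\<Union>(range K) = topspace X" unfolding UK(4) by (intro equalityI UN_least)
    then show ?thesis using M by (simp add: borel_on_def)
  qed
  moreover have "emeasure M (K n) \<noteq> \<infinity>" for n using fin[OF UK(2), of n] by simp
  ultimately show ?thesis
    by (intro sigma_finite_measure.intro exI[of _ "range K"]) auto
qed

text \<open>The generator consists of finite intersections of relatively compact basic open sets:
  second countability keeps it countable, relative compactness makes the measures finite, and
  closure under intersections is what the pi-lambda argument asks for.\<close>

lemma borel_on_countable_generator:
  assumes X: "second_countable X" "locally_compact_space X" "Hausdorff_space X"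
    and M: "borel_on X M" and fin: "\<And>K. compactin X K \<Longrightarrow> emeasure M K < \<infinity>"
  obtains P where "Int_stable P" "countable P" "sets M = sigma_sets (space M) P" "\<Union>P = space M"
    "\<And>A. A \<in> P \<Longrightarrow> emeasure M A < \<infinity>"
proof -
  obtain B where B: "countable B" "\<And>V. V \<in> B \<Longrightarrow> openin X V"
      "\<And>U x. openin X U \<Longrightarrow> x \<in> U \<Longrightarrow> \<exists>V\<in>B. x \<in> V \<and> V \<subseteq> U"
    using X(1) unfolding second_countable_def by metis
  define B' where "B' = {V \<in> B. \<exists>K. compactin X K \<and> V \<subseteq> K}"
  \<comment> \<open>Empty families are excluded because \<open>\<Inter>{}\<close> is the whole
    type.\<close>
  define \<F> where "\<F> = {F. finite F \<and> F \<subseteq> B' \<and> F \<noteq> {}}"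
  define P where "P = Inter ` \<F>"
  have sub: "\<exists>V\<in>B'. x \<in> V \<and> V \<subseteq> U" if U: "openin X U" "x \<in> U" for U x
  proof -
    have "x \<in> topspace X" using U openin_subset by blast
    then obtain W K where WK: "openin X W" "compactin X K" "x \<in> W" "W \<subseteq> K"
      using X(2) unfolding locally_compact_space_def by blast
    then have "openin X (U \<inter> W)" "x \<in> U \<inter> W" using U by auto
    from B(3)[OF this] obtain V where "V \<in> B" "x \<in> V" "V \<subseteq> U \<inter> W" by blast
    then show ?thesis using WK unfolding B'_def by blast
  qed
  have B'P: "B' \<subseteq> P"
  proof
    fix V assume "V \<in> B'"
    then have "\<Inter>{V} \<in> P" unfolding P_def by (intro imageI) (simp add: \<F>_def)
    then show "V \<in> P" by simp
  qed
  have P_open: "openin X A" "\<exists>K. compactin X K \<and> A \<subseteq> K" if A: "A \<in> P" for A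
  proof -
    obtain F where "F \<in> \<F>" and FA: "A = \<Inter>F" using A unfolding P_def by (rule imageE)
    then have F: "finite F" "F \<subseteq> B'" "F \<noteq> {}" by (simp_all add: \<F>_def)
    show "openin X A" unfolding FA using F B(2) by (intro openin_Inter) (auto simp: B'_def)
    obtain V where "V \<in> F" using F(3) by blast
    then have "A \<subseteq> V" "V \<in> B'" using F(2) FA by (simp_all add: Inter_lower subsetD)
    then show "\<exists>K. compactin X K \<and> A \<subseteq> K" unfolding B'_def by blast
  qed
  show ?thesis
  proof (rule that)
    show "Int_stable P"
    proof (rule Int_stableI)
      fix a b assume "a \<in> P" "b \<in> P"
      then obtain F F' where F: "F \<in> \<F>" "F' \<in> \<F>" "a = \<Inter>F" "b = \<Inter>F'"
        unfolding P_def by (elim imageE)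
      then have "a \<inter> b = \<Inter>(F \<union> F')" by (simp only: Inter_Un_distrib)
      moreover have "F \<union> F' \<in> \<F>" using F(1,2) by (simp add: \<F>_def)
      ultimately show "a \<inter> b \<in> P" unfolding P_def by (rule image_eqI)
    qed
    have "countable B'" unfolding B'_def using B(1) by simp
    from countable_Collect_finite_subset[OF this]
    have "countable \<F>" by (rule countable_subset[rotated]) (auto simp: \<F>_def)
    then show "countable P" unfolding P_def by (rule countable_image)
    show "\<Union>P = space M"
    proof
      show "\<Union>P \<subseteq> space M" using P_open(1) openin_subset M unfolding borel_on_def by blast
      have "x \<in> \<Union>P" if "x \<in> topspace X" for x
        using sub[of "topspace X" x] that B'P by blast
      then show "space M \<subseteq> \<Union>P" using M by (auto simp: borel_on_def)
    qed
    have PS: "P \<subseteq> sets M" using P_open(1) borel_on_openin[OF M] by blast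
    show "sets M = sigma_sets (space M) P"
    proof
      show "sigma_sets (space M) P \<subseteq> sets M" using PS by (rule sets.sigma_sets_subset)
      have "U \<in> sigma_sets (space M) P" if U: "openin X U" for U
      proof -
        let ?F = "{V \<in> B'. V \<subseteq> U}"
        have "U = \<Union>?F" using sub[OF U] by blast
        have "countable ?F" using \<open>countable B'\<close> by simp
        moreover have "?F \<subseteq> sigma_sets (space M) P" using B'P by (auto intro: sigma_sets.Basic)
        ultimately have "\<Union>?F \<in> sigma_sets (space M) P" by (intro sigma_sets_UNION) auto
        then show ?thesis using \<open>U = \<Union>?F\<close> by simp
      qed
      then show "sets M \<subseteq> sigma_sets (space M) P"
        using M by (auto simp: borel_on_def intro!: sigma_sets_mono)
    qed
    fix A assume A: "A \<in> P"
    obtain K where K: "compactin X K" "A \<subseteq> K" using P_open(2)[OF A] by blast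
    have "emeasure M A \<le> emeasure M K"
      using K borel_on_compactin[OF M X(3)] by (intro emeasure_mono)
    then show "emeasure M A < \<infinity>" using fin[OF K(1)] by (rule le_less_trans)
  qed
qed

section \<open>Haar measure on a group and on a closed subgroup\<close>

lemma haar_nn_integral_translate:
  assumes "topological_group G T" "left_haar_measure G T \<mu>" "x \<in> carrier G"
    and F: "F \<in> borel_measurable \<mu>"
  shows "(\<integral>\<^sup>+y. F (inv\<^bsub>G\<^esub> x \<otimes>\<^bsub>G\<^esub> y) \<partial>\<mu>) = (\<integral>\<^sup>+y. F y \<partial>\<mu>)"
  using nn_integral_distr[OF left_translation_measure(1)[OF assms(1-3)], of F] F
  by (simp add: left_translation_measure(2)[OF assms(1-3)])

text \<open>Translates of a null set are null, and by the Lindelof property countably many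
  translates of \<open>S\<close> cover the group; so a null \<open>S\<close> would make the whole
  measure zero.\<close>

lemma haar_openin_nonzero:
  fixes G (structure)
  assumes G: "second_countable_lc_group G T" and \<mu>: "left_haar_measure G T \<mu>"
    and S: "openin T S" "S \<noteq> {}"
  shows "emeasure \<mu> S \<noteq> 0"
proof
  assume null: "emeasure \<mu> S = 0"
  have tg: "topological_group G T" using G by (simp add: second_countable_lc_group_def)
  interpret group G using tg by (simp add: topological_group_def)
  have top: "topspace T = carrier G" using tg by (simp add: topological_group_def)
  have sp: "space \<mu> = carrier G" using \<mu> top by (simp add: left_haar_measure_def)
  \<comment> \<open>\<open>t x\<close> is the translate of \<open>S\<close> by \<open>x\<close>,
    written as a preimage: continuity then gives openness, and invariance of \<open>\<mu>\<close> as
    an image measure gives nullity.\<close>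
  define t where "t x = {y \<in> topspace T. inv x \<otimes> y \<in> S}" for x
  have t_open: "openin T (t x)" if x: "x \<in> carrier G" for x
  proof -
    have "continuous_map T (prod_topology T T) (\<lambda>y. (inv x, y))"
      using x top by (intro continuous_map_pairedI) auto
    from continuous_map_compose[OF this, of T "\<lambda>(x, y). x \<otimes> y"] tg
    have "continuous_map T T (\<lambda>y. inv x \<otimes> y)"
      by (simp add: topological_group_def comp_def)
    then show ?thesis using S unfolding t_def continuous_map_def by blast
  qed
  have t_null: "t x \<in> null_sets \<mu>" if x: "x \<in> carrier G" for x
  proof -
    have "t x = (\<lambda>y. inv x \<otimes> y) -` S \<inter> space \<mu>" by (auto simp: t_def sp top)
    then have "emeasure \<mu> (t x) = emeasure (distr \<mu> \<mu> (\<lambda>y. inv x \<otimes> y)) S"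
      using borel_on_openin[OF left_haar_measure_borel_on[OF \<mu>] S(1)]
      by (simp add: emeasure_distr left_translation_measure(1)[OF tg \<mu> x])
    also have "\<dots> = 0" unfolding left_translation_measure(2)[OF tg \<mu> x] by (rule null)
    finally show ?thesis
      using borel_on_openin[OF left_haar_measure_borel_on[OF \<mu>] t_open[OF x]] by auto
  qed
  obtain s where s: "s \<in> S" using S(2) by blast
  then have sG: "s \<in> carrier G" using S(1) openin_subset top by blast
  have "\<Union>(t ` carrier G) = topspace T"
  proof
    show "\<Union>(t ` carrier G) \<subseteq> topspace T" by (auto simp: t_def)
    show "topspace T \<subseteq> \<Union>(t ` carrier G)"
    proof
      fix y assume y: "y \<in> topspace T"
      then have yG: "y \<in> carrier G" using top by simp
      \<comment> \<open>\<open>y\<close> lies in the translate of \<open>S\<close> by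
        \<open>y \<otimes> inv s\<close>, the element that carries \<open>s\<close> to
        \<open>y\<close>.\<close>
      then have "inv (y \<otimes> inv s) \<otimes> y = s"
        using sG by (simp add: inv_mult_group m_assoc)
      then have "y \<in> t (y \<otimes> inv s)" using y s by (simp add: t_def)
      then show "y \<in> \<Union>(t ` carrier G)" using yG sG by (intro UN_I[of "y \<otimes> inv s"]) auto
    qed
  qed
  then have cover: "(\<forall>U\<in>t ` carrier G. openin T U) \<and> \<Union>(t ` carrier G) = topspace T"
    using t_open by simp
  have "Lindelof_space T"
    using G by (simp add: second_countable_lc_group_def second_countable_imp_Lindelof_space)
  from this[unfolded Lindelof_space_def, rule_format, OF cover]
  obtain V where V: "countable V" "V \<subseteq> t ` carrier G" "\<Union>V = topspace T"
    by (elim exE conjE)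
  have "(\<Union>v\<in>V. v) \<in> null_sets \<mu>"
    using V(1,2) t_null by (intro null_sets_UN') auto
  then have "emeasure \<mu> (space \<mu>) = 0" using V(3) by (simp add: sp top null_sets_def)
  then show False using \<mu> by (simp add: left_haar_measure_def)
qed

locale closed_haar_subgroup =
  fixes G :: "('a, 'b) monoid_scheme" (structure) and T H \<mu> \<nu>
  assumes G: "second_countable_lc_group G T"
    and \<mu>: "left_haar_measure G T \<mu>"
    and H: "subgroup H G"
    and H_closed: "closedin T H"
    and \<nu>: "left_haar_measure (G\<lparr>carrier := H\<rparr>) (subtopology T H) \<nu>"
    and H_lc: "second_countable_lc_group (G\<lparr>carrier := H\<rparr>) (subtopology T H)"
begin

lemma topological_group_G: "topological_group G T"
  using G by (simp add: second_countable_lc_group_def)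

lemma topological_group_H: "topological_group (G\<lparr>carrier := H\<rparr>) (subtopology T H)"
  using H_lc by (simp add: second_countable_lc_group_def)

sublocale group G
  using topological_group_G by (simp add: topological_group_def)

lemma topspace_T: "topspace T = carrier G"
  using topological_group_G by (simp add: topological_group_def)

lemma H_carrier: "h \<in> H \<Longrightarrow> h \<in> carrier G"
  using subgroup.subset[OF H] by blast

lemma H_inv: "h \<in> H \<Longrightarrow> inv h \<in> H"
  using H by (rule subgroup.m_inv_closed)

lemma H_mult: "h \<in> H \<Longrightarrow> k \<in> H \<Longrightarrow> h \<otimes> k \<in> H"
  using H by (rule subgroup.m_closed)

lemma inv_H: "h \<in> H \<Longrightarrow> inv\<^bsub>G\<lparr>carrier := H\<rparr>\<^esub> h = inv h"
  using H by (rule m_inv_consistent)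

lemma borel_\<mu>: "borel_on T \<mu>"
  using \<mu> by (rule left_haar_measure_borel_on)

lemma borel_\<nu>: "borel_on (subtopology T H) \<nu>"
  using \<nu> by (rule left_haar_measure_borel_on)

lemma space_\<mu>: "space \<mu> = carrier G"
  using \<mu> topspace_T by (simp add: left_haar_measure_def)

lemma space_\<nu>: "space \<nu> = H"
  using borel_\<nu> closedin_subset[OF H_closed] by (auto simp: borel_on_def)

sublocale M: sigma_finite_measure \<mu>
  using G \<mu> borel_\<mu> by (intro sigma_finite_measure_lc[of T])
    (auto simp: second_countable_lc_group_def left_haar_measure_def)

sublocale N: sigma_finite_measure \<nu>
  using H_lc \<nu> borel_\<nu> by (intro sigma_finite_measure_lc[of "subtopology T H"])
    (auto simp: second_countable_lc_group_def left_haar_measure_def)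

sublocale NM: pair_sigma_finite \<nu> \<mu> ..

lemma topspace_H: "topspace (subtopology T H) = H"
  using closedin_subset[OF H_closed] by auto

lemma continuous_inv_H: "continuous_map (subtopology T H) (subtopology T H) (\<lambda>h. inv h)"
proof -
  have "continuous_map (subtopology T H) (subtopology T H) (\<lambda>h. inv\<^bsub>G\<lparr>carrier := H\<rparr>\<^esub> h)"
    using topological_group_H by (simp add: topological_group_def)
  then show ?thesis
    by (rule continuous_map_eq) (simp add: inv_H)
qed

lemma continuous_mult_H: "continuous_map (prod_topology (subtopology T H) T) T (\<lambda>(h, g). h \<otimes> g)"
proof -
  have "continuous_map (prod_topology T T) T (\<lambda>(x, y). x \<otimes> y)"
    using topological_group_G by (simp add: topological_group_def)
  then show ?thesis
    unfolding prod_topology_subtopology by (rule continuous_map_from_subtopology)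
qed

lemma measurable_mult [measurable]: "(\<lambda>(h, g). h \<otimes> g) \<in> measurable (\<nu> \<Otimes>\<^sub>M \<mu>) \<mu>"
  using G H_lc borel_\<mu> borel_\<nu> continuous_mult_H
  by (intro continuous_map_prod_measurable[of "subtopology T H" T])
    (auto simp: second_countable_lc_group_def)

lemma measurable_inv [measurable]: "(\<lambda>h. inv h) \<in> measurable \<nu> \<nu>"
  using borel_\<nu> borel_\<nu> continuous_inv_H by (rule continuous_map_measurable)

lemma measurable_inv_mult [measurable]: "(\<lambda>(h, g). inv h \<otimes> g) \<in> measurable (\<nu> \<Otimes>\<^sub>M \<mu>) \<mu>"
proof -
  have "(\<lambda>p. (inv (fst p), snd p)) \<in> measurable (\<nu> \<Otimes>\<^sub>M \<mu>) (\<nu> \<Otimes>\<^sub>M \<mu>)"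
    by measurable
  from measurable_compose[OF this measurable_mult] show ?thesis
    by (simp add: case_prod_unfold)
qed

lemma nn_integral_mult_left:
  assumes "h \<in> H" "F \<in> borel_measurable \<mu>"
  shows "(\<integral>\<^sup>+g. F (inv h \<otimes> g) \<partial>\<mu>) = (\<integral>\<^sup>+g. F g \<partial>\<mu>)"
  using assms H_carrier by (intro haar_nn_integral_translate[OF topological_group_G \<mu>]) auto

lemma nn_integral_mult_left_H:
  assumes "h \<in> H" "F \<in> borel_measurable \<nu>"
  shows "(\<integral>\<^sup>+k. F (h \<otimes> k) \<partial>\<nu>) = (\<integral>\<^sup>+k. F k \<partial>\<nu>)"
proof -
  have "inv h \<in> H" using assms H_inv by blast
  then have "inv\<^bsub>G\<lparr>carrier := H\<rparr>\<^esub> (inv h) = h" using assms H_carrier by (simp add: inv_H)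
  then show ?thesis
    using haar_nn_integral_translate[OF topological_group_H \<nu>, of "inv h" F] \<open>inv h \<in> H\<close> assms by simp
qed

lemma continuous_inv_mult_right:
  assumes g: "g \<in> carrier G"
  shows "continuous_map (subtopology T H) T (\<lambda>h. inv h \<otimes> g)"
proof -
  have "continuous_map (subtopology T H) (prod_topology (subtopology T H) T) (\<lambda>h. (inv h, g))"
    using continuous_inv_H g topspace_T by (intro continuous_map_pairedI) auto
  from continuous_map_compose[OF this continuous_mult_H] show ?thesis
    by (simp add: comp_def)
qed

text \<open>The Haar measure of this set is the integral of the indicator of \<open>U\<close> along
  the \<open>H\<close>-orbit of \<open>g\<close>, so bounds on it turn into bounds on orbit
  integrals of sums of indicators.\<close>

definition visits :: "'a set \<Rightarrow> 'a \<Rightarrow> 'a set" where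
  "visits U g = {h \<in> H. inv h \<otimes> g \<in> U}"

lemma openin_visits:
  assumes "openin T U" "g \<in> carrier G"
  shows "openin (subtopology T H) (visits U g)"
proof -
  have "openin (subtopology T H) {h \<in> topspace (subtopology T H). inv h \<otimes> g \<in> U}"
    using continuous_inv_mult_right[OF assms(2)] assms(1) unfolding continuous_map_def by blast
  then show ?thesis by (simp only: visits_def topspace_H)
qed

text \<open>If \<open>h\<^sub>0\<close> is one visit to \<open>U\<close>, then \<open>h\<^sub>0\<^sup>-\<^sup>1\<close> moves all visits of the same orbit into the compact
  set \<open>K K\<^sup>-\<^sup>1 \<inter> H\<close>, so the bound does not depend on the orbit.\<close>

lemma visits_bounded:
  assumes U: "openin T U" and K: "compactin T K" "U \<subseteq> K"
  obtains C where "0 \<le> C" "\<And>g. g \<in> carrier G \<Longrightarrow> emeasure \<nu> (visits U g) \<le> ennreal C"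
proof -
  define Q where "Q = (\<lambda>(x, y). x \<otimes> inv y) ` (K \<times> K) \<inter> H"
  have "continuous_map (prod_topology T T) (prod_topology T T) (\<lambda>p. (fst p, inv (snd p)))"
  proof (rule continuous_map_pairedI)
    have "continuous_map T T (\<lambda>y. inv y)" using topological_group_G by (simp add: topological_group_def)
    from continuous_map_compose[OF continuous_map_snd this]
    show "continuous_map (prod_topology T T) T (\<lambda>p. inv (snd p))" by (simp add: comp_def)
  qed (rule continuous_map_fst)
  from continuous_map_compose[OF this, of T "\<lambda>(x, y). x \<otimes> y"] topological_group_G
  have "continuous_map (prod_topology T T) T (\<lambda>(x, y). x \<otimes> inv y)"
    by (simp add: topological_group_def comp_def case_prod_unfold)
  moreover have "compactin (prod_topology T T) (K \<times> K)" using K by (simp add: compactin_Times)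
  ultimately have "compactin T ((\<lambda>(x, y). x \<otimes> inv y) ` (K \<times> K))" by (intro image_compactin)
  then have "compactin T Q"
    unfolding Q_def by (subst Int_commute) (rule closed_Int_compactin[OF H_closed])
  then have Q: "compactin (subtopology T H) Q" by (simp add: compactin_subtopology Q_def)
  have Q_fin: "emeasure \<nu> Q < \<infinity>" using \<nu> Q by (simp add: left_haar_measure_def)
  have Q_sets: "Q \<in> sets \<nu>"
    using H_lc by (intro borel_on_compactin[OF borel_\<nu> _ Q]) (simp add: second_countable_lc_group_def)
  have "emeasure \<nu> (visits U g) \<le> emeasure \<nu> Q" if g: "g \<in> carrier G" for g
  proof (cases "visits U g = {}")
    case False
    then obtain h0 where h0: "h0 \<in> H" "inv h0 \<otimes> g \<in> U" by (auto simp: visits_def)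
    note [simp] = H_carrier[OF h0(1)] g
    have "visits U g \<subseteq> h0 <#\<^bsub>G\<lparr>carrier := H\<rparr>\<^esub> Q"
    proof
      fix h assume h: "h \<in> visits U g"
      then have hH: "h \<in> H" and hU: "inv h \<otimes> g \<in> U" by (auto simp: visits_def)
      note [simp] = H_carrier[OF hH]
      \<comment> \<open>The quotient of two points of one orbit is free of \<open>g\<close>, which
        puts \<open>inv h0 \<otimes> h\<close> into the compact set of quotients of elements of
        \<open>K\<close>.\<close>
      have "g \<otimes> (inv g \<otimes> h) = h" by (simp add: m_assoc[symmetric])
      then have "(inv h0 \<otimes> g) \<otimes> inv (inv h \<otimes> g) = inv h0 \<otimes> h"
        by (simp add: inv_mult_group m_assoc)
      then have eq: "inv h0 \<otimes> h = (\<lambda>(x, y). x \<otimes> inv y) (inv h0 \<otimes> g, inv h \<otimes> g)" by simp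
      have "inv h0 \<otimes> h \<in> Q"
        unfolding Q_def
      proof
        show "inv h0 \<otimes> h \<in> (\<lambda>(x, y). x \<otimes> inv y) ` (K \<times> K)"
          using h0 hU K(2) eq by (intro image_eqI[where x = "(inv h0 \<otimes> g, inv h \<otimes> g)"]) auto
        show "inv h0 \<otimes> h \<in> H" using h0 hH by (intro H_mult H_inv)
      qed
      moreover have "h = h0 \<otimes> (inv h0 \<otimes> h)" by (simp add: m_assoc[symmetric])
      ultimately show "h \<in> h0 <#\<^bsub>G\<lparr>carrier := H\<rparr>\<^esub> Q" by (auto simp: l_coset_def)
    qed
    \<comment> \<open>Monotonicity of \<open>emeasure\<close> asks for a measurable superset; the
      translate of \<open>Q\<close> is compact, hence closed.\<close>
    moreover have "h0 <#\<^bsub>G\<lparr>carrier := H\<rparr>\<^esub> Q \<in> sets \<nu>"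
    proof -
      have "continuous_map (subtopology T H) (subtopology T H) (\<lambda>k. h0 \<otimes> k)"
      proof (rule continuous_map_into_subtopology)
        have "continuous_map (subtopology T H) (prod_topology (subtopology T H) T) (\<lambda>k. (h0, k))"
          using h0 closedin_subset[OF H_closed] by (intro continuous_map_pairedI continuous_map_id_subt[unfolded id_def]) auto
        from continuous_map_compose[OF this continuous_mult_H]
        show "continuous_map (subtopology T H) T (\<lambda>k. h0 \<otimes> k)" by (simp add: comp_def)
        show "(\<lambda>k. h0 \<otimes> k) \<in> topspace (subtopology T H) \<rightarrow> H" using h0 H_mult by auto
      qed
      moreover have "h0 <#\<^bsub>G\<lparr>carrier := H\<rparr>\<^esub> Q = (\<lambda>k. h0 \<otimes> k) ` Q"
        by (auto simp: l_coset_def)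
      ultimately have "compactin (subtopology T H) (h0 <#\<^bsub>G\<lparr>carrier := H\<rparr>\<^esub> Q)"
        using image_compactin[OF Q] by simp
      then show ?thesis
        using H_lc by (intro borel_on_compactin[OF borel_\<nu>]) (simp_all add: second_countable_lc_group_def)
    qed
    ultimately have "emeasure \<nu> (visits U g) \<le> emeasure \<nu> (h0 <#\<^bsub>G\<lparr>carrier := H\<rparr>\<^esub> Q)"
      by (intro emeasure_mono)
    also have "\<dots> = emeasure \<nu> Q" using \<nu> h0(1) Q_sets by (simp add: left_haar_measure_def)
    finally show ?thesis .
  qed simp
  then show ?thesis using Q_fin by (intro that[of "enn2real (emeasure \<nu> Q)"]) auto
qed

end

section \<open>A weight normalised along the orbits of the subgroup\<close>

context closed_haar_subgroup
begin

definition orbit_integral :: "('a \<Rightarrow> ennreal) \<Rightarrow> 'a \<Rightarrow> ennreal" where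
  "orbit_integral B g = (\<integral>\<^sup>+h. B (inv h \<otimes> g) \<partial>\<nu>)"

lemma measurable_inv_mult_right: "g \<in> carrier G \<Longrightarrow> (\<lambda>h. inv h \<otimes> g) \<in> measurable \<nu> \<mu>"
  using borel_\<nu> borel_\<mu> continuous_inv_mult_right by (rule continuous_map_measurable)

lemma measurable_orbit_integral:
  assumes [measurable]: "B \<in> borel_measurable \<mu>"
  shows "orbit_integral B \<in> borel_measurable \<mu>"
proof -
  have "(\<lambda>p. B (inv (fst p) \<otimes> snd p)) \<in> borel_measurable (\<nu> \<Otimes>\<^sub>M \<mu>)"
    using measurable_compose[OF measurable_inv_mult assms] by (simp add: case_prod_unfold)
  then have "(\<lambda>(g, h). B (inv h \<otimes> g)) \<in> borel_measurable (\<mu> \<Otimes>\<^sub>M \<nu>)"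
    by (subst measurable_pair_swap_iff) (simp add: case_prod_unfold)
  then show ?thesis
    unfolding orbit_integral_def[abs_def] by (rule N.borel_measurable_nn_integral)
qed

text \<open>Substituting \<open>x \<otimes> h\<close> for \<open>h\<close>, which left invariance of
  \<open>\<nu>\<close> permits, absorbs \<open>x\<close>. Division by the orbit integral therefore
  puts a single constant denominator into each orbit integral of the quotient.\<close>

lemma orbit_integral_invariant:
  assumes x: "x \<in> H" and g: "g \<in> carrier G" and B: "B \<in> borel_measurable \<mu>"
  shows "orbit_integral B (inv x \<otimes> g) = orbit_integral B g"
proof -
  have "orbit_integral B (inv x \<otimes> g) = (\<integral>\<^sup>+h. B (inv (x \<otimes> h) \<otimes> g) \<partial>\<nu>)"
    unfolding orbit_integral_def using x g
    by (intro nn_integral_cong) (simp add: space_\<nu> H_carrier inv_mult_group m_assoc)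
  also have "\<dots> = orbit_integral B g"
    unfolding orbit_integral_def
    using measurable_compose[OF measurable_inv_mult_right[OF g] B]
    by (intro nn_integral_mult_left_H[OF x])
  finally show ?thesis .
qed

text \<open>Finiteness comes from coefficients \<open>c n\<close> that beat the bounds on visits.
  Positivity comes from the identity of \<open>H\<close>: it visits some \<open>U n\<close>, so the
  visits to \<open>U n\<close> form a nonempty open set, which has positive Haar measure.\<close>

lemma bruhat_function_exists:
  obtains B where "B \<in> borel_measurable \<mu>" "\<And>g. B g < \<infinity>"
    "\<And>g. g \<in> carrier G \<Longrightarrow> 0 < orbit_integral B g" "\<And>g. g \<in> carrier G \<Longrightarrow> orbit_integral B g < \<infinity>"
proof -
  obtain U K :: "nat \<Rightarrow> 'a set" where U: "\<And>n. openin T (U n)" and K: "\<And>n. compactin T (K n)"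
      "\<And>n. U n \<subseteq> K n" and cover: "(\<Union>n. U n) = topspace T"
    using G countable_relatively_compact_cover[of T] by (auto simp: second_countable_lc_group_def)
  have "\<exists>C\<ge>0. \<forall>g\<in>carrier G. emeasure \<nu> (visits (U n) g) \<le> ennreal C" for n
    using visits_bounded[OF U K, of n] by metis
  then obtain C where C: "\<And>n. 0 \<le> C n"
      "\<And>n g. g \<in> carrier G \<Longrightarrow> emeasure \<nu> (visits (U n) g) \<le> ennreal (C n)"
    by metis
  \<comment> \<open>The factor \<open>1 / (1 + C n)\<close> keeps both \<open>c n\<close> and
    \<open>c n * C n\<close> below \<open>(1/2)^n\<close>: the first bounds \<open>B\<close>, the
    second its orbit integrals.\<close>
  define c where "c n = (1/2)^n * (1 / (1 + C n))" for n
  have c_pos: "0 < c n" for n using C(1)[of n] by (simp add: c_def)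
  have c_le: "c n \<le> (1/2)^n" "c n * C n \<le> (1/2)^n" for n
  proof -
    have "(1/2)^n * (1 / (1 + C n)) \<le> (1/2)^n * 1" "(1/2)^n * (C n / (1 + C n)) \<le> (1/2)^n * 1"
      using C(1)[of n] by (intro mult_left_mono; simp add: divide_le_eq)+
    then show "c n \<le> (1/2)^n" "c n * C n \<le> (1/2)^n" by (simp_all add: c_def)
  qed
  have geo: "(\<Sum>n. ennreal ((1/2)^n)) < \<infinity>"
    using summable_geometric[of "1/2::real"] by (subst suminf_ennreal2) auto
  have U_meas [measurable]: "U n \<in> sets \<mu>" for n using borel_on_openin[OF borel_\<mu> U] .
  define B where "B g = (\<Sum>n. ennreal (c n) * indicator (U n) g)" for g
  have orbit: "orbit_integral B g = (\<Sum>n. ennreal (c n) * emeasure \<nu> (visits (U n) g))"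
    if g: "g \<in> carrier G" for g
  proof -
    have V [measurable]: "visits (U n) g \<in> sets \<nu>" for n using borel_on_openin[OF borel_\<nu> openin_visits[OF U g]] .
    have "orbit_integral B g = (\<integral>\<^sup>+h. (\<Sum>n. ennreal (c n) * indicator (visits (U n) g) h) \<partial>\<nu>)"
      unfolding orbit_integral_def B_def
      by (intro nn_integral_cong suminf_cong) (simp add: visits_def space_\<nu> indicator_def)
    also have "\<dots> = (\<Sum>n. \<integral>\<^sup>+h. ennreal (c n) * indicator (visits (U n) g) h \<partial>\<nu>)"
      using V by (intro nn_integral_suminf) measurable
    also have "\<dots> = (\<Sum>n. ennreal (c n) * emeasure \<nu> (visits (U n) g))"
      using V by (simp add: nn_integral_cmult)
    finally show ?thesis .
  qed
  show ?thesis
  proof (rule that)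
    show "B \<in> borel_measurable \<mu>" unfolding B_def by measurable
    fix g
    have "B g \<le> (\<Sum>n. ennreal ((1/2)^n))"
      unfolding B_def using c_le(1) by (intro suminf_le) (auto simp: indicator_def intro!: ennreal_leI)
    then show "B g < \<infinity>" using geo by (rule le_less_trans)
    assume g: "g \<in> carrier G"
    have "ennreal (c n) * emeasure \<nu> (visits (U n) g) \<le> ennreal ((1/2)^n)" for n
    proof -
      have "ennreal (c n) * emeasure \<nu> (visits (U n) g) \<le> ennreal (c n) * ennreal (C n)"
        using C(2)[OF g] by (intro mult_left_mono) auto
      also have "\<dots> \<le> ennreal ((1/2)^n)"
        using c_le(2) c_pos[of n] C(1)[of n] by (simp flip: ennreal_mult add: ennreal_leI)
      finally show ?thesis .
    qed
    then have "orbit_integral B g \<le> (\<Sum>n. ennreal ((1/2)^n))"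
      unfolding orbit[OF g] by (intro suminf_le) auto
    then show "orbit_integral B g < \<infinity>" using geo by (rule le_less_trans)
    obtain n where n: "g \<in> U n" using g cover topspace_T by blast
    have one_H: "\<one> \<in> H" using H by (rule subgroup.one_closed)
    then have "\<one> \<in> visits (U n) g" using n g by (simp add: visits_def)
    then have "emeasure \<nu> (visits (U n) g) \<noteq> 0"
      using haar_openin_nonzero[OF H_lc \<nu> openin_visits[OF U g]] by blast
    then have "0 < ennreal (c n) * emeasure \<nu> (visits (U n) g)"
      using c_pos[of n] by (simp add: ennreal_zero_less_mult_iff zero_less_iff_neq_zero)
    also have "\<dots> \<le> orbit_integral B g"
      unfolding orbit[OF g]
      using sum_le_suminf[of "\<lambda>n. ennreal (c n) * emeasure \<nu> (visits (U n) g)" "{n}"] by simp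
    finally show "0 < orbit_integral B g" .
  qed
qed

lemma orbit_weight_exists:
  obtains w :: "'a \<Rightarrow> real" where "w \<in> borel_measurable \<mu>"
    "\<And>g. g \<in> carrier G \<Longrightarrow> (\<integral>\<^sup>+h. ennreal ((w (inv h \<otimes> g))\<^sup>2) \<partial>\<nu>) = 1"
proof -
  obtain B where B [measurable]: "B \<in> borel_measurable \<mu>" and fin: "\<And>g. B g < \<infinity>"
    and pos: "\<And>g. g \<in> carrier G \<Longrightarrow> 0 < orbit_integral B g"
      "\<And>g. g \<in> carrier G \<Longrightarrow> orbit_integral B g < \<infinity>"
    using bruhat_function_exists by blast
  note [measurable] = measurable_orbit_integral[OF B]
  \<comment> \<open>The square root is there because the isometry involves the square of
    \<open>w\<close>. On the carrier the quotient is finite, so \<open>enn2real\<close> loses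
    nothing.\<close>
  define w where "w g = sqrt (enn2real (B g / orbit_integral B g))" for g
  have w_sq: "ennreal ((w g)\<^sup>2) = B g / orbit_integral B g" if "g \<in> carrier G" for g
  proof -
    have "B g / orbit_integral B g \<noteq> \<infinity>"
      using fin[of g] pos[OF that] by (auto simp: ennreal_divide_eq_top_iff)
    then show ?thesis by (simp add: w_def less_top)
  qed
  show ?thesis
  proof (rule that)
    show "w \<in> borel_measurable \<mu>" unfolding w_def by measurable
    fix g assume g: "g \<in> carrier G"
    have "(\<integral>\<^sup>+h. ennreal ((w (inv h \<otimes> g))\<^sup>2) \<partial>\<nu>) = (\<integral>\<^sup>+h. B (inv h \<otimes> g) / orbit_integral B g \<partial>\<nu>)"
      using g by (intro nn_integral_cong)
        (simp add: space_\<nu> w_sq H_carrier orbit_integral_invariant[OF _ g B])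
    also have "\<dots> = orbit_integral B g / orbit_integral B g"
      using measurable_compose[OF measurable_inv_mult_right[OF g] B]
      unfolding orbit_integral_def by (rule nn_integral_divide)
    also have "\<dots> = 1" using pos[OF g] by (intro ennreal_divide_self) auto
    finally show "(\<integral>\<^sup>+h. ennreal ((w (inv h \<otimes> g))\<^sup>2) \<partial>\<nu>) = 1" .
  qed
qed

end

section \<open>The isometric intertwiner\<close>

lemma L2_vecsD:
  assumes "F \<in> vecs (L2 \<mu>)"
  shows "L2_rep F \<in> L2_fun \<mu>" "L2_class \<mu> (L2_rep F) = F"
proof -
  obtain f where f: "f \<in> L2_fun \<mu>" "F = L2_class \<mu> f" using assms by (auto simp: L2_def)
  show "L2_rep F \<in> L2_fun \<mu>" unfolding f(2) by (rule L2_rep_class(1)[OF f(1)])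
  show "L2_class \<mu> (L2_rep F) = F" unfolding f(2) by (rule L2_class_cong[OF L2_rep_class(2)[OF f(1)]])
qed

lemma L2_class_in_vecs: "f \<in> L2_fun \<mu> \<Longrightarrow> L2_class \<mu> f \<in> vecs (L2 \<mu>)"
  by (simp add: L2_def)

lemma vinner_L2_class:
  assumes "f \<in> L2_fun \<mu>" "g \<in> L2_fun \<mu>"
  shows "vinner (L2 \<mu>) (L2_class \<mu> f) (L2_class \<mu> g) = ip \<mu> f g"
  using L2_vinner_class[OF assms] by (simp add: ip_def)

lemma vinner_L2_eq_ip: "vinner (L2 \<mu>) F F' = ip \<mu> (L2_rep F) (L2_rep F')"
  by (simp add: L2_def ip_def)

lemma vnorm_L2_eq_nsq: "(vnorm (L2 \<mu>) F)\<^sup>2 = nsq \<mu> (L2_rep F)"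
  by (simp add: vnorm_def vinner_L2_eq_ip ip_self)

lemma vadd_L2:
  assumes "F \<in> vecs (L2 \<mu>)" "F' \<in> vecs (L2 \<mu>)"
  shows "vadd (L2 \<mu>) F F' \<in> vecs (L2 \<mu>)"
  using assms by (auto simp: L2_def L2_fun_add L2_rep_class(1))

lemma vscale_L2:
  assumes "F \<in> vecs (L2 \<mu>)"
  shows "vscale (L2 \<mu>) c F \<in> vecs (L2 \<mu>)"
  using assms by (auto simp: L2_def L2_fun_scale L2_rep_class(1))

lemma vinner_vadd_L2:
  assumes "F \<in> vecs (L2 \<mu>)" "F' \<in> vecs (L2 \<mu>)" "K \<in> vecs (L2 \<mu>)"
  shows "vinner (L2 \<mu>) (vadd (L2 \<mu>) F F') K = vinner (L2 \<mu>) F K + vinner (L2 \<mu>) F' K"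
proof -
  note L = L2_vecsD[OF assms(1)] L2_vecsD[OF assms(2)] L2_vecsD[OF assms(3)]
  have "vinner (L2 \<mu>) (vadd (L2 \<mu>) F F') K
      = vinner (L2 \<mu>) (L2_class \<mu> (\<lambda>x. L2_rep F x + L2_rep F' x)) (L2_class \<mu> (L2_rep K))"
    using L by (simp add: L2_def)
  also have "\<dots> = ip \<mu> (\<lambda>x. L2_rep F x + L2_rep F' x) (L2_rep K)"
    using L by (intro vinner_L2_class L2_fun_add)
  finally show ?thesis using L by (simp add: ip_add_left vinner_L2_eq_ip)
qed

lemma vinner_vscale_L2:
  assumes "F \<in> vecs (L2 \<mu>)" "K \<in> vecs (L2 \<mu>)"
  shows "vinner (L2 \<mu>) (vscale (L2 \<mu>) c F) K = c * vinner (L2 \<mu>) F K"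
proof -
  note L = L2_vecsD[OF assms(1)] L2_vecsD[OF assms(2)]
  have "vinner (L2 \<mu>) (vscale (L2 \<mu>) c F) K
      = vinner (L2 \<mu>) (L2_class \<mu> (\<lambda>x. c * L2_rep F x)) (L2_class \<mu> (L2_rep K))"
    using L by (simp add: L2_def)
  also have "\<dots> = ip \<mu> (\<lambda>x. c * L2_rep F x) (L2_rep K)"
    using L by (intro vinner_L2_class L2_fun_scale)
  finally show ?thesis by (simp add: ip_scale_left vinner_L2_eq_ip)
qed

lemma left_regular_in_vecs:
  assumes "topological_group G T" "left_haar_measure G T \<mu>" "x \<in> carrier G" "F \<in> vecs (L2 \<mu>)"
  shows "left_regular G \<mu> x F \<in> vecs (L2 \<mu>)"
  unfolding left_regular_def
  by (intro L2_class_in_vecs left_regular_class(1)[OF assms(1-3)] L2_vecsD(1)[OF assms(4)])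

text \<open>Substituting \<open>inv x \<otimes> y\<close> for \<open>y\<close> preserves
  \<open>\<mu>\<close>. In this form a translation of the frame vector becomes a translation of the
  vector tested against it, on which the intertwiner acts.\<close>

lemma left_regular_adjoint:
  fixes G (structure)
  assumes G: "topological_group G T" and \<mu>: "left_haar_measure G T \<mu>" and x: "x \<in> carrier G"
    and F: "F \<in> vecs (L2 \<mu>)" and F': "F' \<in> vecs (L2 \<mu>)"
  shows "vinner (L2 \<mu>) (left_regular G \<mu> (inv x) F) F' = vinner (L2 \<mu>) F (left_regular G \<mu> x F')"
proof -
  interpret group G using G by (simp add: topological_group_def)
  have sp: "space \<mu> = carrier G" using G \<mu> by (simp add: topological_group_def left_haar_measure_def)
  define f f' where "f = L2_rep F" and "f' = L2_rep F'"
  have f: "f \<in> L2_fun \<mu>" "F = L2_class \<mu> f" and f': "f' \<in> L2_fun \<mu>" "F' = L2_class \<mu> f'"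
    using L2_vecsD[OF F] L2_vecsD[OF F'] by (simp_all add: f_def f'_def)
  have ix: "inv x \<in> carrier G" using x by simp
  have fx: "(\<lambda>y. f (x \<otimes> y)) \<in> L2_fun \<mu>"
    using left_regular_class(1)[OF G \<mu> ix f(1)] x by simp
  have f'x: "(\<lambda>y. f' (inv x \<otimes> y)) \<in> L2_fun \<mu>"
    using left_regular_class(1)[OF G \<mu> x f'(1)] .
  have "vinner (L2 \<mu>) (left_regular G \<mu> (inv x) F) F' = ip \<mu> (\<lambda>y. f (x \<otimes> y)) f'"
    using x unfolding f(2) f'(2) left_regular_class(2)[OF G \<mu> ix f(1)]
    by (simp add: vinner_L2_class fx f'(1))
  also have "\<dots> = (\<integral>y. f (x \<otimes> y) * cnj (f' y) \<partial>distr \<mu> \<mu> (\<lambda>y. inv x \<otimes> y))"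
    unfolding ip_def left_translation_measure(2)[OF G \<mu> x] ..
  also have "\<dots> = (\<integral>y. f (x \<otimes> (inv x \<otimes> y)) * cnj (f' (inv x \<otimes> y)) \<partial>\<mu>)"
    using L2_fun_measurable[OF fx] L2_fun_measurable[OF f'(1)]
    by (intro integral_distr left_translation_measure(1)[OF G \<mu> x] borel_measurable_times
        borel_measurable_cnj)
  also have "\<dots> = ip \<mu> f (\<lambda>y. f' (inv x \<otimes> y))"
    unfolding ip_def using x
    by (intro Bochner_Integration.integral_cong) (auto simp: sp m_assoc[symmetric])
  also have "\<dots> = vinner (L2 \<mu>) F (left_regular G \<mu> x F')"
    unfolding f(2) f'(2) left_regular_class(2)[OF G \<mu> x f'(1)]
    by (simp add: vinner_L2_class f f'x)
  finally show ?thesis .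
qed

section \<open>The lift to the product of subgroup and group, and its coefficients\<close>

locale orbit_embedding = closed_haar_subgroup +
  fixes w :: "'a \<Rightarrow> real" and e :: "nat \<Rightarrow> 'a \<Rightarrow> complex"
  assumes w_measurable [measurable]: "w \<in> borel_measurable \<mu>"
    and w_orbit: "\<And>g. g \<in> carrier G \<Longrightarrow> (\<integral>\<^sup>+h. ennreal ((w (inv h \<otimes> g))\<^sup>2) \<partial>\<nu>) = 1"
    and e: "orthonormal_seq \<mu> e" "parseval_set \<mu> e = L2_fun \<mu>"
begin

lemma e_L2: "e n \<in> L2_fun \<mu>"
  using e by (simp add: orthonormal_seq_def)

definition lift :: "('a \<Rightarrow> complex) \<Rightarrow> 'a \<Rightarrow> 'a \<Rightarrow> complex" where
  "lift f h g = f (h \<otimes> g) * of_real (w g)"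

lemma measurable_lift:
  assumes [measurable]: "f \<in> borel_measurable \<mu>"
  shows "(\<lambda>(h, g). lift f h g) \<in> borel_measurable (\<nu> \<Otimes>\<^sub>M \<mu>)"
proof -
  have [measurable]: "(\<lambda>p. f (fst p \<otimes> snd p)) \<in> borel_measurable (\<nu> \<Otimes>\<^sub>M \<mu>)"
    using measurable_compose[OF measurable_mult assms] by (simp add: case_prod_unfold)
  show ?thesis unfolding lift_def case_prod_unfold by measurable
qed

lemma measurable_lift_slice:
  assumes "f \<in> borel_measurable \<mu>" "h \<in> H"
  shows "lift f h \<in> borel_measurable \<mu>"
  using measurable_compose_Pair1[OF _ measurable_lift[OF assms(1)], of h] assms(2) space_\<nu> by simp

text \<open>Replacing \<open>g\<close> by \<open>inv h \<otimes> g\<close> moves \<open>h\<close>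
  out of \<open>f\<close> and into \<open>w\<close>; after the exchange of integrals the inner one
  is the normalisation \<open>w_orbit\<close>. Nonnegative integrals allow this for every measurable
  \<open>f\<close>, so integrability of the lift becomes a consequence.\<close>

lemma lift_isometry:
  assumes f: "f \<in> borel_measurable \<mu>"
  shows "(\<integral>\<^sup>+h. \<integral>\<^sup>+g. ennreal ((cmod (lift f h g))\<^sup>2) \<partial>\<mu> \<partial>\<nu>) = (\<integral>\<^sup>+g. ennreal ((cmod (f g))\<^sup>2) \<partial>\<mu>)"
proof -
  note [measurable] = f
  have wm: "(\<lambda>p. w (inv (fst p) \<otimes> snd p)) \<in> borel_measurable (\<nu> \<Otimes>\<^sub>M \<mu>)"
    using measurable_compose[OF measurable_inv_mult w_measurable] by (simp add: case_prod_unfold)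
  let ?k = "\<lambda>h g. ennreal ((cmod (f g))\<^sup>2) * ennreal ((w (inv h \<otimes> g))\<^sup>2)"
  have km: "(\<lambda>(h, g). ?k h g) \<in> borel_measurable (\<nu> \<Otimes>\<^sub>M \<mu>)"
    using wm unfolding case_prod_unfold by measurable
  have "(\<integral>\<^sup>+g. ennreal ((cmod (lift f h g))\<^sup>2) \<partial>\<mu>) = (\<integral>\<^sup>+g. ?k h g \<partial>\<mu>)" if h: "h \<in> H" for h
  proof -
    note [measurable] = measurable_lift_slice[OF f h]
    have "(\<integral>\<^sup>+g. ennreal ((cmod (lift f h g))\<^sup>2) \<partial>\<mu>)
        = (\<integral>\<^sup>+g. ennreal ((cmod (lift f h (inv h \<otimes> g)))\<^sup>2) \<partial>\<mu>)"
      by (rule nn_integral_mult_left[OF h, symmetric]) measurable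
    also have "\<dots> = (\<integral>\<^sup>+g. ?k h g \<partial>\<mu>)"
      using h H_carrier[OF h] by (intro nn_integral_cong)
        (simp add: lift_def space_\<mu> m_assoc[symmetric] norm_mult power_mult_distrib flip: ennreal_mult)
    finally show ?thesis .
  qed
  then have "(\<integral>\<^sup>+h. \<integral>\<^sup>+g. ennreal ((cmod (lift f h g))\<^sup>2) \<partial>\<mu> \<partial>\<nu>) = (\<integral>\<^sup>+h. \<integral>\<^sup>+g. ?k h g \<partial>\<mu> \<partial>\<nu>)"
    by (rule nn_integral_cong) (simp add: space_\<nu>)
  also have "\<dots> = (\<integral>\<^sup>+g. \<integral>\<^sup>+h. ?k h g \<partial>\<nu> \<partial>\<mu>)"
    by (rule NM.Fubini'[OF km, symmetric])
  also have "\<dots> = (\<integral>\<^sup>+g. ennreal ((cmod (f g))\<^sup>2) \<partial>\<mu>)"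
  proof (rule nn_integral_cong)
    fix g assume "g \<in> space \<mu>"
    then have g: "g \<in> carrier G" by (simp add: space_\<mu>)
    have "(\<lambda>h. w (inv h \<otimes> g)) \<in> borel_measurable \<nu>"
      using measurable_compose[OF measurable_inv_mult_right[OF g] w_measurable] .
    then show "(\<integral>\<^sup>+h. ?k h g \<partial>\<nu>) = ennreal ((cmod (f g))\<^sup>2)"
      using w_orbit[OF g] by (simp add: nn_integral_cmult)
  qed
  finally show ?thesis .
qed

lemma AE_lift_L2:
  assumes f: "f \<in> L2_fun \<mu>"
  shows "AE h in \<nu>. lift f h \<in> L2_fun \<mu>"
proof -
  note fm [measurable] = L2_fun_measurable[OF f]
  have "(\<lambda>(h, g). ennreal ((cmod (lift f h g))\<^sup>2)) \<in> borel_measurable (\<nu> \<Otimes>\<^sub>M \<mu>)"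
    using measurable_lift[OF fm] unfolding case_prod_unfold by measurable
  then have m: "(\<lambda>h. \<integral>\<^sup>+g. ennreal ((cmod (lift f h g))\<^sup>2) \<partial>\<mu>) \<in> borel_measurable \<nu>"
    by (rule M.borel_measurable_nn_integral)
  have "(\<integral>\<^sup>+h. \<integral>\<^sup>+g. ennreal ((cmod (lift f h g))\<^sup>2) \<partial>\<mu> \<partial>\<nu>) \<noteq> \<infinity>"
    unfolding lift_isometry[OF fm] nn_integral_eq_nsq[OF f] by simp
  from nn_integral_PInf_AE[OF m this] AE_space show ?thesis
    by eventually_elim (simp add: L2_fun_nn_integral measurable_lift_slice fm space_\<nu> less_top)
qed

definition orbit_coeff :: "nat \<Rightarrow> ('a \<Rightarrow> complex) \<Rightarrow> 'a \<Rightarrow> complex" where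
  "orbit_coeff n f h = ip \<mu> (lift f h) (e n)"

lemma measurable_orbit_coeff:
  assumes f: "f \<in> borel_measurable \<mu>"
  shows "orbit_coeff n f \<in> borel_measurable \<nu>"
proof -
  note [measurable] = L2_fun_measurable[OF e_L2, of n]
  have "(\<lambda>(h, g). lift f h g * cnj (e n g)) \<in> borel_measurable (\<nu> \<Otimes>\<^sub>M \<mu>)"
    using measurable_lift[OF f] unfolding case_prod_unfold by measurable
  then show ?thesis
    unfolding orbit_coeff_def[abs_def] ip_def by (rule M.borel_measurable_lebesgue_integral)
qed

text \<open>Parseval in the variable \<open>g\<close> on almost every slice, followed by integration
  over \<open>h\<close>; for nonnegative terms sum and integral commute.\<close>

lemma orbit_coeff_nn_integral:
  assumes f: "f \<in> L2_fun \<mu>"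
  shows "(\<Sum>n. \<integral>\<^sup>+h. ennreal ((cmod (orbit_coeff n f h))\<^sup>2) \<partial>\<nu>) = ennreal (nsq \<mu> f)"
proof -
  note [measurable] = measurable_orbit_coeff[OF L2_fun_measurable[OF f]]
  have "AE h in \<nu>. (\<Sum>n. ennreal ((cmod (orbit_coeff n f h))\<^sup>2)) = (\<integral>\<^sup>+g. ennreal ((cmod (lift f h g))\<^sup>2) \<partial>\<mu>)"
    using AE_lift_L2[OF f]
  proof eventually_elim
    case (elim h)
    then have "(\<lambda>n. (cmod (orbit_coeff n f h))\<^sup>2) sums nsq \<mu> (lift f h)"
      using e(2) unfolding orbit_coeff_def parseval_set_def by blast
    then have "(\<Sum>n. ennreal ((cmod (orbit_coeff n f h))\<^sup>2)) = ennreal (nsq \<mu> (lift f h))"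
      by (subst suminf_ennreal2) (auto simp: sums_iff)
    then show ?case by (simp add: nn_integral_eq_nsq[OF elim])
  qed
  then have "(\<integral>\<^sup>+h. (\<Sum>n. ennreal ((cmod (orbit_coeff n f h))\<^sup>2)) \<partial>\<nu>) = ennreal (nsq \<mu> f)"
    using lift_isometry[OF L2_fun_measurable[OF f]] nn_integral_eq_nsq[OF f]
    by (simp cong: nn_integral_cong_AE)
  then show ?thesis by (subst (asm) nn_integral_suminf) auto
qed

lemma orbit_coeff_L2:
  assumes f: "f \<in> L2_fun \<mu>"
  shows "orbit_coeff n f \<in> L2_fun \<nu>"
proof -
  have "(\<integral>\<^sup>+h. ennreal ((cmod (orbit_coeff n f h))\<^sup>2) \<partial>\<nu>) \<le> ennreal (nsq \<mu> f)"
    using sum_le_suminf[of "\<lambda>n. \<integral>\<^sup>+h. ennreal ((cmod (orbit_coeff n f h))\<^sup>2) \<partial>\<nu>" "{n}"]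
    by (simp add: orbit_coeff_nn_integral[OF f])
  then show ?thesis
    using measurable_orbit_coeff[OF L2_fun_measurable[OF f]]
    by (subst L2_fun_nn_integral) (auto intro: le_less_trans)
qed

lemma orbit_coeff_sums:
  assumes f: "f \<in> L2_fun \<mu>"
  shows "(\<lambda>n. nsq \<nu> (orbit_coeff n f)) sums nsq \<mu> f"
proof -
  have eq: "(\<Sum>n. ennreal (nsq \<nu> (orbit_coeff n f))) = ennreal (nsq \<mu> f)"
    using orbit_coeff_nn_integral[OF f] by (simp add: nn_integral_eq_nsq orbit_coeff_L2[OF f])
  then have s: "summable (\<lambda>n. nsq \<nu> (orbit_coeff n f))"
    by (intro summable_suminf_not_top) auto
  with eq have "(\<Sum>n. nsq \<nu> (orbit_coeff n f)) = nsq \<mu> f"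
    by (simp add: suminf_ennreal2 suminf_nonneg)
  with s show ?thesis by (simp add: sums_iff)
qed

text \<open>Only almost everywhere: where a slice \<open>lift f h\<close> fails to be square
  integrable, the Bochner integral of one summand may fall back to its default value 0, and
  additivity can break.\<close>

lemma orbit_coeff_add:
  assumes f: "f \<in> L2_fun \<mu>" and g: "g \<in> L2_fun \<mu>"
  shows "AE h in \<nu>. orbit_coeff n (\<lambda>x. f x + g x) h = orbit_coeff n f h + orbit_coeff n g h"
  using AE_lift_L2[OF f] AE_lift_L2[OF g]
proof eventually_elim
  case (elim h)
  have "lift (\<lambda>x. f x + g x) h = (\<lambda>x. lift f h x + lift g h x)"
    by (simp add: lift_def distrib_right fun_eq_iff)
  then show ?case using elim by (simp add: orbit_coeff_def ip_add_left e_L2)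
qed

lemma orbit_coeff_scale: "orbit_coeff n (\<lambda>x. c * f x) h = c * orbit_coeff n f h"
proof -
  have "lift (\<lambda>x. c * f x) h = (\<lambda>x. c * lift f h x)"
    by (simp add: lift_def fun_eq_iff)
  then show ?thesis by (simp add: orbit_coeff_def ip_scale_left)
qed

text \<open>Associativity turns \<open>inv x \<otimes> (h \<otimes> g)\<close> into
  \<open>(inv x \<otimes> h) \<otimes> g\<close>, so the translation acts on \<open>h\<close> and
  leaves \<open>w g\<close> and \<open>e n g\<close> alone.\<close>

lemma orbit_coeff_translate:
  assumes x: "x \<in> H" and h: "h \<in> H"
  shows "orbit_coeff n (\<lambda>y. f (inv x \<otimes> y)) h = orbit_coeff n f (inv x \<otimes> h)"
  unfolding orbit_coeff_def ip_def lift_def using x h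
  by (intro Bochner_Integration.integral_cong) (auto simp: space_\<mu> m_assoc H_carrier)

end

section \<open>Transfer of the frame through the infinite multiple\<close>

context orbit_embedding
begin

definition embed :: "('a \<Rightarrow> complex) \<Rightarrow> nat \<Rightarrow> ('a \<Rightarrow> complex) set" where
  "embed f n = L2_class \<nu> (orbit_coeff n f)"

lemma vinner_embed:
  assumes "f \<in> L2_fun \<mu>"
  shows "vinner (L2 \<nu>) (embed f n) (embed f n) = of_real (nsq \<nu> (orbit_coeff n f))"
  unfolding embed_def using orbit_coeff_L2[OF assms, of n] by (simp add: vinner_L2_class ip_self)

lemma embed_in_vecs:
  assumes f: "f \<in> L2_fun \<mu>"
  shows "embed f \<in> vecs (infinite_sum_space (L2 \<nu>))"
proof -
  have "(vnorm (L2 \<nu>) (embed f n))\<^sup>2 = nsq \<nu> (orbit_coeff n f)" for n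
    by (simp add: vnorm_def vinner_embed[OF f])
  then show ?thesis
    using orbit_coeff_sums[OF f] orbit_coeff_L2[OF f]
    by (auto simp: infinite_sum_space_def embed_def sums_iff intro: L2_class_in_vecs)
qed

lemma vinner_embed_sum:
  assumes f: "f \<in> L2_fun \<mu>"
  shows "vinner (infinite_sum_space (L2 \<nu>)) (embed f) (embed f) = of_real (nsq \<mu> f)"
proof -
  have "(\<lambda>n. complex_of_real (nsq \<nu> (orbit_coeff n f))) sums of_real (nsq \<mu> f)"
    using orbit_coeff_sums[OF f] by (rule sums_of_real)
  then show ?thesis by (simp add: infinite_sum_space_def vinner_embed[OF f] sums_iff)
qed

lemma embed_add:
  assumes f: "f \<in> L2_fun \<mu>" and g: "g \<in> L2_fun \<mu>"
  shows "embed (\<lambda>x. f x + g x) = vadd (infinite_sum_space (L2 \<nu>)) (embed f) (embed g)"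
proof
  fix n
  have "embed (\<lambda>x. f x + g x) n = L2_class \<nu> (\<lambda>h. orbit_coeff n f h + orbit_coeff n g h)"
    unfolding embed_def by (rule L2_class_cong[OF orbit_coeff_add[OF f g]])
  then show "embed (\<lambda>x. f x + g x) n = vadd (infinite_sum_space (L2 \<nu>)) (embed f) (embed g) n"
    using orbit_coeff_L2[OF f, of n] orbit_coeff_L2[OF g, of n]
    by (simp add: infinite_sum_space_def embed_def L2_vadd_class)
qed

lemma embed_scale:
  assumes f: "f \<in> L2_fun \<mu>"
  shows "embed (\<lambda>x. c * f x) = vscale (infinite_sum_space (L2 \<nu>)) c (embed f)"
  using orbit_coeff_L2[OF f]
  by (simp add: infinite_sum_space_def embed_def L2_vscale_class orbit_coeff_scale[abs_def] fun_eq_iff)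

lemma embed_translate:
  assumes x: "x \<in> H" and f: "f \<in> L2_fun \<mu>"
  shows "embed (\<lambda>y. f (inv x \<otimes> y))
    = infinite_sum_rep (left_regular (G\<lparr>carrier := H\<rparr>) \<nu>) x (embed f)"
proof
  fix n
  have "left_regular (G\<lparr>carrier := H\<rparr>) \<nu> x (embed f n)
      = L2_class \<nu> (\<lambda>h. orbit_coeff n f (inv\<^bsub>G\<lparr>carrier := H\<rparr>\<^esub> x \<otimes>\<^bsub>G\<lparr>carrier := H\<rparr>\<^esub> h))"
    unfolding embed_def using x
    by (intro left_regular_class(2)[OF topological_group_H \<nu>] orbit_coeff_L2[OF f]) simp
  also have "\<dots> = L2_class \<nu> (orbit_coeff n (\<lambda>y. f (inv x \<otimes> y)))"
    by (intro L2_class_cong AE_I2) (simp add: space_\<nu> inv_H[OF x] orbit_coeff_translate[OF x])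
  finally show "embed (\<lambda>y. f (inv x \<otimes> y)) n
      = infinite_sum_rep (left_regular (G\<lparr>carrier := H\<rparr>) \<nu>) x (embed f) n"
    by (simp add: infinite_sum_rep_def embed_def)
qed

text \<open>\<open>R\<close> follows the embedding by the inverse of \<open>U\<close>, and the Riesz
  vector of the functional \<open>l\<close> is the adjoint image of \<open>\<Phi>\<close>. Every
  frame coefficient of \<open>F\<close> equals that of its image under \<open>R\<close>, and norms
  agree too, so both frame bounds carry over unchanged.\<close>

lemma frame_transfer:
  assumes U: "unitary_map (L2 \<nu>) (infinite_sum_space (L2 \<nu>)) U"
    and U_inter: "\<And>x F. x \<in> H \<Longrightarrow> F \<in> vecs (L2 \<nu>) \<Longrightarrow>
      U (left_regular (G\<lparr>carrier := H\<rparr>) \<nu> x F)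
        = infinite_sum_rep (left_regular (G\<lparr>carrier := H\<rparr>) \<nu>) x (U F)"
    and \<Gamma>: "\<Gamma> \<subseteq> H" and \<Phi>: "\<Phi> \<in> vecs (L2 \<nu>)"
    and frame: "is_frame (L2 \<nu>) \<Gamma> (\<lambda>x. left_regular (G\<lparr>carrier := H\<rparr>) \<nu> x \<Phi>)"
  shows "\<exists>\<phi> \<in> vecs (L2 \<mu>). is_frame (L2 \<mu>) \<Gamma> (\<lambda>x. left_regular G \<mu> x \<phi>)"
proof -
  let ?S = "infinite_sum_space (L2 \<nu>)"
  let ?L = "left_regular (G\<lparr>carrier := H\<rparr>) \<nu>"
  have bij: "bij_betw U (vecs (L2 \<nu>)) (vecs ?S)"
    and U_add: "\<And>v w. v \<in> vecs (L2 \<nu>) \<Longrightarrow> w \<in> vecs (L2 \<nu>) \<Longrightarrow> U (vadd (L2 \<nu>) v w) = vadd ?S (U v) (U w)"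
    and U_scale: "\<And>c v. v \<in> vecs (L2 \<nu>) \<Longrightarrow> U (vscale (L2 \<nu>) c v) = vscale ?S c (U v)"
    and U_inner: "\<And>v w. v \<in> vecs (L2 \<nu>) \<Longrightarrow> w \<in> vecs (L2 \<nu>) \<Longrightarrow> vinner ?S (U v) (U w) = vinner (L2 \<nu>) v w"
    using U by (simp_all add: unitary_map_def)
  define R where "R f = inv_into (vecs (L2 \<nu>)) U (embed f)" for f
  have R: "R f \<in> vecs (L2 \<nu>)" "U (R f) = embed f" if "f \<in> L2_fun \<mu>" for f
  proof -
    have "embed f \<in> U ` vecs (L2 \<nu>)"
      using bij embed_in_vecs[OF that] by (simp add: bij_betw_def)
    then show "R f \<in> vecs (L2 \<nu>)" "U (R f) = embed f"
      unfolding R_def by (rule inv_into_into, rule f_inv_into_f)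
  qed
  \<comment> \<open>The algebraic properties of \<open>R\<close> reduce to injectivity of
    \<open>U\<close>: both sides are vectors with the same image.\<close>
  have R_eqI: "R f = v" if "v \<in> vecs (L2 \<nu>)" "U v = embed f" for f v
    unfolding R_def that(2)[symmetric] using bij that(1) by (simp add: bij_betw_def inv_into_f_f)
  have R_add: "R (\<lambda>x. f x + g x) = vadd (L2 \<nu>) (R f) (R g)" if "f \<in> L2_fun \<mu>" "g \<in> L2_fun \<mu>" for f g
    using that by (intro R_eqI vadd_L2) (simp_all add: R U_add embed_add)
  have R_scale: "R (\<lambda>x. c * f x) = vscale (L2 \<nu>) c (R f)" if "f \<in> L2_fun \<mu>" for c f
    using that by (intro R_eqI vscale_L2) (simp_all add: R U_scale embed_scale)
  have R_translate: "R (\<lambda>y. f (inv x \<otimes> y)) = ?L x (R f)" if "x \<in> H" "f \<in> L2_fun \<mu>" for x f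
    using that by (intro R_eqI left_regular_in_vecs[OF topological_group_H \<nu>])
      (simp_all add: R U_inter embed_translate)
  have R_norm: "nsq \<nu> (L2_rep (R f)) = nsq \<mu> f" if "f \<in> L2_fun \<mu>" for f
  proof -
    have "complex_of_real (nsq \<nu> (L2_rep (R f))) = vinner ?S (U (R f)) (U (R f))"
      using R(1)[OF that] by (simp add: U_inner vinner_L2_eq_ip ip_self)
    also have "\<dots> = of_real (nsq \<mu> f)" using that by (simp add: R vinner_embed_sum)
    finally show ?thesis by simp
  qed
  define l where "l f = vinner (L2 \<nu>) (R f) \<Phi>" for f
  obtain \<phi> where \<phi>: "\<phi> \<in> L2_fun \<mu>" and l: "\<And>f. f \<in> L2_fun \<mu> \<Longrightarrow> l f = ip \<mu> f \<phi>"
  \<comment> \<open>The constant comes from Cauchy-Schwarz against \<open>\<Phi>\<close>, with the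
    isometry replacing the norm of \<open>R f\<close> by that of \<open>f\<close>.\<close>
  proof (rule riesz_L2[OF e, of l "nsq \<nu> (L2_rep \<Phi>)"])
    show "l (\<lambda>x. f x + g x) = l f + l g" if "f \<in> L2_fun \<mu>" "g \<in> L2_fun \<mu>" for f g
      using that by (simp add: l_def R_add vinner_vadd_L2 R \<Phi>)
    show "l (\<lambda>x. c * f x) = c * l f" if "f \<in> L2_fun \<mu>" for c f
      using that by (simp add: l_def R_scale vinner_vscale_L2 R \<Phi>)
    show "(cmod (l f))\<^sup>2 \<le> nsq \<nu> (L2_rep \<Phi>) * nsq \<mu> f" if "f \<in> L2_fun \<mu>" for f
      using cauchy_schwarz[OF L2_vecsD(1)[OF R(1)[OF that]] L2_vecsD(1)[OF \<Phi>]]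
      by (simp add: l_def vinner_L2_eq_ip R_norm[OF that] mult.commute)
  qed blast
  define \<phi>' where "\<phi>' = L2_class \<mu> \<phi>"
  have \<phi>': "\<phi>' \<in> vecs (L2 \<mu>)" unfolding \<phi>'_def using \<phi> by (rule L2_class_in_vecs)
  \<comment> \<open>The translation by \<open>x\<close> is moved from \<open>\<phi>'\<close> to
    \<open>F\<close> as one by the inverse, passes through \<open>R\<close>, and is moved back onto
    \<open>\<Phi>\<close> inside \<open>L2 \<nu>\<close>.\<close>
  have key: "vinner (L2 \<mu>) F (left_regular G \<mu> x \<phi>') = vinner (L2 \<nu>) (R (L2_rep F)) (?L x \<Phi>)"
    if F: "F \<in> vecs (L2 \<mu>)" and x: "x \<in> H" for F x
  proof -
    let ?f = "L2_rep F"
    note f = L2_vecsD[OF F]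
    note xG = H_carrier[OF x] and ix = H_inv[OF x]
    note ixG = H_carrier[OF ix]
    note tr = left_regular_class[OF topological_group_G \<mu> ixG f(1)]
    have "vinner (L2 \<mu>) F (left_regular G \<mu> x \<phi>') = vinner (L2 \<mu>) (left_regular G \<mu> (inv x) F) \<phi>'"
      by (rule left_regular_adjoint[OF topological_group_G \<mu> xG F \<phi>', symmetric])
    \<comment> \<open>The double inverse is kept so that \<open>R_translate\<close> matches at the
      element \<open>inv x\<close>.\<close>
    also have "\<dots> = ip \<mu> (\<lambda>y. ?f (inv (inv x) \<otimes> y)) \<phi>"
      using vinner_L2_class[OF tr(1) \<phi>] tr(2) unfolding f(2) \<phi>'_def by simp
    also have "\<dots> = vinner (L2 \<nu>) (R (\<lambda>y. ?f (inv (inv x) \<otimes> y))) \<Phi>"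
      using l[OF tr(1)] by (simp add: l_def)
    also have "\<dots> = vinner (L2 \<nu>) (?L (inv\<^bsub>G\<lparr>carrier := H\<rparr>\<^esub> x) (R ?f)) \<Phi>"
      by (simp only: R_translate[OF ix f(1)] inv_H[OF x])
    also have "\<dots> = vinner (L2 \<nu>) (R ?f) (?L x \<Phi>)"
      using x by (intro left_regular_adjoint[OF topological_group_H \<nu>] R f \<Phi>) simp
    finally show ?thesis .
  qed
  have norm: "(vnorm (L2 \<mu>) F)\<^sup>2 = (vnorm (L2 \<nu>) (R (L2_rep F)))\<^sup>2" if "F \<in> vecs (L2 \<mu>)" for F
    using L2_vecsD(1)[OF that] by (simp add: vnorm_L2_eq_nsq R_norm)
  obtain A B :: real where AB: "0 < A" "A \<le> B" and
    bounds: "\<And>F. F \<in> vecs (L2 \<nu>) \<Longrightarrow> (\<lambda>x. (cmod (vinner (L2 \<nu>) F (?L x \<Phi>)))\<^sup>2) summable_on \<Gamma> \<and>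
      A * (vnorm (L2 \<nu>) F)\<^sup>2 \<le> (\<Sum>\<^sub>\<infinity>x\<in>\<Gamma>. (cmod (vinner (L2 \<nu>) F (?L x \<Phi>)))\<^sup>2) \<and>
      (\<Sum>\<^sub>\<infinity>x\<in>\<Gamma>. (cmod (vinner (L2 \<nu>) F (?L x \<Phi>)))\<^sup>2) \<le> B * (vnorm (L2 \<nu>) F)\<^sup>2"
    using frame unfolding is_frame_def by blast
  have "is_frame (L2 \<mu>) \<Gamma> (\<lambda>x. left_regular G \<mu> x \<phi>')"
    unfolding is_frame_def
  proof (intro conjI exI ballI)
    show "left_regular G \<mu> x \<phi>' \<in> vecs (L2 \<mu>)" if "x \<in> \<Gamma>" for x
      using that \<Gamma> \<phi>' H_carrier by (intro left_regular_in_vecs[OF topological_group_G \<mu>]) auto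
    show "0 < A" "A \<le> B" by fact+
    fix F assume F: "F \<in> vecs (L2 \<mu>)"
    have eq: "(cmod (vinner (L2 \<mu>) F (left_regular G \<mu> x \<phi>')))\<^sup>2
        = (cmod (vinner (L2 \<nu>) (R (L2_rep F)) (?L x \<Phi>)))\<^sup>2" if "x \<in> \<Gamma>" for x
      using key[OF F] that \<Gamma> by auto
    note b = bounds[OF R(1)[OF L2_vecsD(1)[OF F]]]
    have sums: "(\<Sum>\<^sub>\<infinity>x\<in>\<Gamma>. (cmod (vinner (L2 \<mu>) F (left_regular G \<mu> x \<phi>')))\<^sup>2)
        = (\<Sum>\<^sub>\<infinity>x\<in>\<Gamma>. (cmod (vinner (L2 \<nu>) (R (L2_rep F)) (?L x \<Phi>)))\<^sup>2)"
      using eq by (rule infsum_cong)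
    show "(\<lambda>x. (cmod (vinner (L2 \<mu>) F (left_regular G \<mu> x \<phi>')))\<^sup>2) summable_on \<Gamma>"
    proof -
      have "(\<lambda>x. (cmod (vinner (L2 \<mu>) F (left_regular G \<mu> x \<phi>')))\<^sup>2) summable_on \<Gamma> \<longleftrightarrow>
          (\<lambda>x. (cmod (vinner (L2 \<nu>) (R (L2_rep F)) (?L x \<Phi>)))\<^sup>2) summable_on \<Gamma>"
        using eq by (rule summable_on_cong)
      then show ?thesis using b by blast
    qed
    show "A * (vnorm (L2 \<mu>) F)\<^sup>2 \<le> (\<Sum>\<^sub>\<infinity>x\<in>\<Gamma>. (cmod (vinner (L2 \<mu>) F (left_regular G \<mu> x \<phi>')))\<^sup>2)"
      unfolding sums norm[OF F] using b by blast
    show "(\<Sum>\<^sub>\<infinity>x\<in>\<Gamma>. (cmod (vinner (L2 \<mu>) F (left_regular G \<mu> x \<phi>')))\<^sup>2) \<le> B * (vnorm (L2 \<mu>) F)\<^sup>2"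
      unfolding sums norm[OF F] using b by blast
  qed
  with \<phi>' show ?thesis by blast
qed

end

theorem theorem3p5:
  fixes G :: "'a monoid" and T :: "'a topology" and H :: "'a set" and \<mu> \<nu> :: "'a measure"
  assumes "second_countable_lc_group G T"
    and "left_haar_measure G T \<mu>"
    and "subgroup H G"
    and "closedin T H"
    and "left_haar_measure (G\<lparr>carrier := H\<rparr>) (subtopology T H) \<nu>"
    and "FT_group (G\<lparr>carrier := H\<rparr>) (subtopology T H) \<nu>"
    and "infinite_multiplicity (G\<lparr>carrier := H\<rparr>) (L2 \<nu>) (left_regular (G\<lparr>carrier := H\<rparr>) \<nu>)"
  shows "FT_group G T \<mu> \<and>
    (\<exists>\<phi> \<Gamma>. \<phi> \<in> vecs (L2 \<mu>) \<and> \<Gamma> \<subseteq> H \<and>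
       is_frame (L2 \<mu>) \<Gamma> (\<lambda>x. left_regular G \<mu> x \<phi>))"
proof -
  \<comment> \<open>The FT hypothesis on \<open>H\<close> also supplies that \<open>H\<close> is a
    second countable locally compact group.\<close>
  interpret closed_haar_subgroup G T H \<mu> \<nu>
    using assms by (intro closed_haar_subgroup.intro) (simp_all add: FT_group_def)
  obtain w :: "'a \<Rightarrow> real" where w: "w \<in> borel_measurable \<mu>"
      "\<And>g. g \<in> carrier G \<Longrightarrow> (\<integral>\<^sup>+h. ennreal ((w (inv\<^bsub>G\<^esub> h \<otimes>\<^bsub>G\<^esub> g))\<^sup>2) \<partial>\<nu>) = 1"
    using orbit_weight_exists by blast
  have lc: "second_countable T" "locally_compact_space T" "Hausdorff_space T"
    and fin: "\<And>K. compactin T K \<Longrightarrow> emeasure \<mu> K < \<infinity>"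
    using G \<mu> by (simp_all add: second_countable_lc_group_def left_haar_measure_def)
  obtain P where P: "Int_stable P" "countable P" "sets \<mu> = sigma_sets (space \<mu>) P" "\<Union>P = space \<mu>"
      "\<And>A. A \<in> P \<Longrightarrow> emeasure \<mu> A < \<infinity>"
    using borel_on_countable_generator[OF lc borel_\<mu> fin] by blast
  obtain e where e: "orthonormal_seq \<mu> e" "parseval_set \<mu> e = L2_fun \<mu>"
    using L2_parseval_seq_exists[OF P] by blast
  interpret orbit_embedding G T H \<mu> \<nu> w e
    using w e by unfold_locales
  obtain \<Gamma> \<Phi> where \<Gamma>: "\<Gamma> \<subseteq> H" "\<Phi> \<in> vecs (L2 \<nu>)"
      "is_frame (L2 \<nu>) \<Gamma> (\<lambda>x. left_regular (G\<lparr>carrier := H\<rparr>) \<nu> x \<Phi>)"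
    using assms(6) by (auto simp: FT_group_def)
  obtain U where U: "unitary_map (L2 \<nu>) (infinite_sum_space (L2 \<nu>)) U"
      "\<And>x F. x \<in> H \<Longrightarrow> F \<in> vecs (L2 \<nu>) \<Longrightarrow> U (left_regular (G\<lparr>carrier := H\<rparr>) \<nu> x F)
        = infinite_sum_rep (left_regular (G\<lparr>carrier := H\<rparr>) \<nu>) x (U F)"
    using assms(7) by (auto simp: infinite_multiplicity_def unitarily_equivalent_def)
  obtain \<phi> where "\<phi> \<in> vecs (L2 \<mu>)" "is_frame (L2 \<mu>) \<Gamma> (\<lambda>x. left_regular G \<mu> x \<phi>)"
    using frame_transfer[OF U \<Gamma>] by blast
  \<comment> \<open>The same \<open>\<Gamma>\<close> and \<open>\<phi>\<close> witness both
    conjuncts.\<close>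
  moreover have "\<Gamma> \<subseteq> carrier G" using \<Gamma>(1) H_carrier by blast
  ultimately show ?thesis
    using assms(1,2) \<Gamma>(1) unfolding FT_group_def by blast
qed

end
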